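(* Suppose that $\mathrm{char}(\mathbb{K})\neq 2,3$ and let $n\ge 1$. Then $\Phi_3(\mathbb{P}^n,\mathcal{O}_{\mathbb{P}^n}(2))\subset\mathbb{P}\big(I(\mathbb{P}^n,\mathcal{O}_{\mathbb{P}^n}(2))_2\big)$ is projectively equivalent to the second Veronese embedding of the Plücker embedding $\mathbb{G}(1,\mathbb{P}^n)\subset\mathbb{P}^{\binom{n+1}{2}-1}$, i.e. to the linearly normal embedding $\mathbb{G}_2\subset\mathbb{P}H^0(\mathbb{G}(1,\mathbb{P}^n),A^2)$ of $\mathbb{G}(1,\mathbb{P}^n)$ defined by the complete linear system $|A^2|$, where $A$ is the Plücker line bundle.
   Context: $\mathbb{K}$ is an algebraically closed field. The complete linear system of $\mathcal{O}_{\mathbb{P}^n}(2)$ embeds $\mathbb{P}^n$ as the second Veronese variety in $\mathbb{P}^r$, $r=\binom{n+2}{2}-1$; $I(\mathbb{P}^n,\mathcal{O}_{\mathbb{P}^n}(2))$ is its homogeneous ideal in $S=\mathbb{K}[x_0,\dots,x_r]$, with degree-2 part $I(\mathbb{P}^n,\mathcal{O}_{\mathbb{P}^n}(2))_2$. The rank of a nonzero quadratic form is the smallest $k$ such that it is a sum of $k$ squares of linear forms, and $$\Phi_3(\mathbb{P}^n,\mathcal{O}_{\mathbb{P}^n}(2))=\{[Q]\mid Q\in I(\mathbb{P}^n,\mathcal{O}_{\mathbb{P}^n}(2))_2\setminus\{0\},\ \mathrm{rank}(Q)\le3\},$$ a subset of the projective space of one-dimensional subspaces of $I(\mathbb{P}^n,\mathcal{O}_{\mathbb{P}^n}(2))_2$.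 $\mathbb{G}(1,\mathbb{P}^n)$ is the Grassmannian of lines in $\mathbb{P}^n$, and $A$ is the very ample line bundle on it defining the Plücker embedding into $\mathbb{P}^{\binom{n+1}{2}-1}$ (the very ample generator of its Picard group when $n\ge2$). $\mathbb{P}H^0(\mathbb{G}(1,\mathbb{P}^n),A^2)$ is the target of the map given by the complete linear system $|A^2|$. Two closed subsets of projective spaces are projectively equivalent if some linear isomorphism of the ambient projective spaces carries one onto the other. *)

theory Defs
  imports
    "HOL-Computational_Algebra.Computational_Algebra"
    "HOL-Library.Poly_Mapping"
    "HOL-Library.Multiset"
    "HOL-Library.Function_Algebras"
begin

section \<open>Polynomials in several variables\<close>

text \<open>
  The finite multisets over \<open>'i\<close> are the free commutative monoid on \<open>'i\<close>, so that
  \<open>'i multiset \<Rightarrow>\<^sub>0 'k\<close>, with the convolution product of \<^theory>\<open>HOL-Library.Poly_Mapping\<close>, is the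
  polynomial ring over \<open>'k\<close> with variables indexed by \<open>'i\<close>; the multiset \<open>{#i, j#}\<close> is the
  monomial \<open>x\<^sub>i x\<^sub>j\<close>.
\<close>

type_synonym ('i, 'k) mpol = "'i multiset \<Rightarrow>\<^sub>0 'k"

definition poly_ring :: "'i set \<Rightarrow> ('i, 'k::zero) mpol set" where
  "poly_ring I = {p. \<forall>m\<in>Poly_Mapping.keys p. set_mset m \<subseteq> I}"

definition forms :: "'i set \<Rightarrow> nat \<Rightarrow> ('i, 'k::zero) mpol set" where
  "forms I d = {p. Poly_Mapping.keys p \<subseteq> multisets_of_size I d}"

definition peval :: "('i, 'k::comm_semiring_1) mpol \<Rightarrow> ('i \<Rightarrow> 'k) \<Rightarrow> 'k" where
  "peval p v = (\<Sum>m\<in>Poly_Mapping.keys p. Poly_Mapping.lookup p m * (\<Prod>i\<in>#m. v i))"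

definition pscale :: "'k::comm_semiring_1 \<Rightarrow> ('i, 'k) mpol \<Rightarrow> ('i, 'k) mpol" where
  "pscale c p = Poly_Mapping.map (\<lambda>y. c * y) p"

definition fscale :: "'k::times \<Rightarrow> ('a \<Rightarrow> 'k) \<Rightarrow> ('a \<Rightarrow> 'k)" where
  "fscale c f = (\<lambda>x. c * f x)"

lemma lookup_pscale [simp]: "Poly_Mapping.lookup (pscale c p) m = c * Poly_Mapping.lookup p m"
  by (simp add: pscale_def Poly_Mapping.map.rep_eq when_def)

interpretation pvec: vector_space "pscale :: 'k::field \<Rightarrow> ('i, 'k) mpol \<Rightarrow> ('i, 'k) mpol"
  by unfold_locales (auto simp: lookup_add algebra_simps intro!: poly_mapping_eqI)

interpretation fvec: vector_space "fscale :: 'k::field \<Rightarrow> ('a \<Rightarrow> 'k) \<Rightarrow> ('a \<Rightarrow> 'k)"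
  by unfold_locales (auto simp: fscale_def algebra_simps)

section \<open>Projective spaces, their subsets and projective equivalence\<close>

text \<open>Points of \<open>\<P>(V)\<close> are the one-dimensional subspaces of \<open>V\<close>.\<close>

definition coord_space :: "'i set \<Rightarrow> ('i \<Rightarrow> 'k::zero) set" where
  "coord_space I = {v. \<forall>i. i \<notin> I \<longrightarrow> v i = 0}"

definition proj_space :: "('i \<Rightarrow> 'k::field) set \<Rightarrow> ('i \<Rightarrow> 'k) set set" where
  "proj_space V = {L. fvec.subspace L \<and> L \<subseteq> V \<and> fvec.dim L = 1}"

text \<open>The punctured affine cone, i.e. all vectors of homogeneous coordinates of points of \<open>X\<close>.\<close>

definition cone :: "('i \<Rightarrow> 'k::zero) set set \<Rightarrow> ('i \<Rightarrow> 'k) set" where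
  "cone X = \<Union>X - {0}"

text \<open>
  \<open>X \<subseteq> \<P>(V)\<close> and \<open>Y \<subseteq> \<P>(W)\<close> are projectively equivalent if a linear isomorphism \<open>V \<rightarrow> W\<close> carries
  \<open>X\<close> onto \<open>Y\<close>. Here \<open>V\<close> and \<open>W\<close> are subspaces of larger vector spaces, and \<open>f\<close> is an extension of
  this isomorphism to the whole space, which always exists.
\<close>

definition proj_equiv ::
  "('k::field \<Rightarrow> 'a::ab_group_add \<Rightarrow> 'a) \<Rightarrow> 'a set \<Rightarrow> 'a set set \<Rightarrow>
   ('k \<Rightarrow> 'b::ab_group_add \<Rightarrow> 'b) \<Rightarrow> 'b set \<Rightarrow> 'b set set \<Rightarrow> bool" where
  "proj_equiv s V X s' W Y \<longleftrightarrow>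
     (\<exists>f. Vector_Spaces.linear s s' f \<and> bij_betw f V W \<and> (\<lambda>L. f ` L) ` X = Y)"

section \<open>Veronese maps, homogeneous ideals and rank of quadratic forms\<close>

text \<open>
  The \<open>d\<close>-th Veronese map on \<open>\<P>(K\<^sup>I)\<close>; the coordinates of the target are indexed by the
  monomials of degree \<open>d\<close> in the variables \<open>I\<close>.
\<close>

definition veronese_vec :: "'i set \<Rightarrow> nat \<Rightarrow> ('i \<Rightarrow> 'k::comm_semiring_1) \<Rightarrow> ('i multiset \<Rightarrow> 'k)" where
  "veronese_vec I d v = (\<lambda>m. if m \<in> multisets_of_size I d then \<Prod>i\<in>#m. v i else 0)"

definition veronese :: "'i set \<Rightarrow> nat \<Rightarrow> ('i \<Rightarrow> 'k::field) set set \<Rightarrow> ('i multiset \<Rightarrow> 'k) set set" where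
  "veronese I d X = {fvec.span {veronese_vec I d v} | v. v \<in> cone X}"

lemma card_veronese_coordinates: "card (multisets_of_size {..n::nat} 2) = (n + 2) choose 2"
  by (simp add: card_multisets_of_size)

definition homogeneous_ideal :: "'i set \<Rightarrow> ('i \<Rightarrow> 'k::field) set set \<Rightarrow> ('i, 'k) mpol set" where
  "homogeneous_ideal I X = {p \<in> poly_ring I. \<forall>v\<in>cone X. peval p v = 0}"

definition quadric_rank :: "'i set \<Rightarrow> ('i, 'k::field) mpol \<Rightarrow> nat" where
  "quadric_rank I Q = (LEAST k. \<exists>l. (\<forall>i<k. l i \<in> forms I 1) \<and> Q = (\<Sum>i<k. (l i)\<^sup>2))"

text \<open>\<open>I(\<P>\<^sup>n, O(2))\<^sub>2\<close> and \<open>\<Phi>\<^sub>3(\<P>\<^sup>n, O(2))\<close>.\<close>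

definition veronese_variety :: "nat \<Rightarrow> (nat multiset \<Rightarrow> 'k::field) set set" where
  "veronese_variety n = veronese {..n} 2 (proj_space (coord_space {..n}))"

definition veronese_ideal_2 :: "nat \<Rightarrow> (nat multiset, 'k::field) mpol set" where
  "veronese_ideal_2 n =
     (let J = multisets_of_size {..n} 2
      in homogeneous_ideal J (veronese_variety n) \<inter> forms J 2)"

definition Phi3 :: "nat \<Rightarrow> (nat multiset, 'k::field) mpol set set" where
  "Phi3 n = {pvec.span {Q} | Q. Q \<in> veronese_ideal_2 n - {0} \<and>
     quadric_rank (multisets_of_size {..n} 2) Q \<le> 3}"

section \<open>The Grassmannian of lines and its Pluecker embedding\<close>

definition grassmannian_lines :: "nat \<Rightarrow> (nat \<Rightarrow> 'k::field) set set" where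
  "grassmannian_lines n = {W. fvec.subspace W \<and> W \<subseteq> coord_space {..n} \<and> fvec.dim W = 2}"

definition pluecker_index :: "nat \<Rightarrow> (nat \<times> nat) set" where
  "pluecker_index n = {(i, j). i < j \<and> j \<le> n}"

definition wedge :: "(nat \<Rightarrow> 'k::field) \<Rightarrow> (nat \<Rightarrow> 'k) \<Rightarrow> (nat \<times> nat \<Rightarrow> 'k)" where
  "wedge u v = (\<lambda>(i, j). if i < j then u i * v j - u j * v i else 0)"

definition pluecker :: "nat \<Rightarrow> (nat \<times> nat \<Rightarrow> 'k::field) set set" where
  "pluecker n = {fvec.span {wedge u v} | u v. fvec.span {u, v} \<in> grassmannian_lines n}"

section \<open>Global sections and complete linear systems\<close>

text \<open>
  \<open>H\<^sup>0(X, O\<^sub>X(d))\<close> for a closed \<open>X \<subseteq> \<P>(K\<^sup>I)\<close> with its reduced structure: a section is a function on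
  the punctured cone which Zariski locally on \<open>X\<close> is a quotient \<open>F/G\<close> of forms with
  \<open>deg F - deg G = d\<close>. The form \<open>H\<close> describes a basic open neighbourhood of \<open>p\<close>.
  Being \<open>0\<close> off the cone is only a normalisation, making the section a function on the whole type.
  For \<open>X\<close> the Pluecker image of the Grassmannian, \<open>O\<^sub>X(1)\<close> is the Pluecker line bundle \<open>A\<close> and
  \<open>O\<^sub>X(d)\<close> is \<open>A\<^sup>d\<close>.
\<close>

definition global_sections ::
  "'i set \<Rightarrow> ('i \<Rightarrow> 'k::field) set set \<Rightarrow> nat \<Rightarrow> (('i \<Rightarrow> 'k) \<Rightarrow> 'k) set" where
  "global_sections I X d = {s. (\<forall>v. v \<notin> cone X \<longrightarrow> s v = 0) \<and>
     (\<forall>p\<in>cone X. \<exists>a e H F G.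
        H \<in> forms I a \<and> F \<in> forms I (d + e) \<and> G \<in> forms I e \<and> peval H p \<noteq> 0 \<and>
        (\<forall>q\<in>cone X. peval H q \<noteq> 0 \<longrightarrow> peval G q \<noteq> 0 \<and> s q = peval F q / peval G q))}"

text \<open>
  The linear dual of a space \<open>V\<close> of functions; functionals are normalised to be \<open>0\<close> off \<open>V\<close>.
\<close>

definition dual :: "('a \<Rightarrow> 'k::field) set \<Rightarrow> (('a \<Rightarrow> 'k) \<Rightarrow> 'k) set" where
  "dual V = {\<phi>. (\<forall>s\<in>V. \<forall>t\<in>V. \<phi> (s + t) = \<phi> s + \<phi> t) \<and>
     (\<forall>c. \<forall>s\<in>V. \<phi> (fscale c s) = c * \<phi> s) \<and> (\<forall>s. s \<notin> V \<longrightarrow> \<phi> s = 0)}"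

text \<open>
  The image of \<open>X\<close> under the map given by the complete linear system \<open>|O\<^sub>X(d)|\<close>. This map sends a
  point with coordinate vector \<open>v\<close> to the class of the evaluation functional \<open>s \<mapsto> s(v)\<close> in the
  projective space of one-dimensional subspaces of the dual of \<open>H\<^sup>0(X, O\<^sub>X(d))\<close>; in terms of a
  basis \<open>s\<^sub>0, \<dots>, s\<^sub>m\<close> of sections it is \<open>[v] \<mapsto> [s\<^sub>0(v) : \<dots> : s\<^sub>m(v)]\<close>.
\<close>

definition evaluation :: "('a \<Rightarrow> 'k::field) set \<Rightarrow> 'a \<Rightarrow> (('a \<Rightarrow> 'k) \<Rightarrow> 'k)" where
  "evaluation V v = (\<lambda>s. if s \<in> V then s v else 0)"

definition linear_system_image ::
  "'i set \<Rightarrow> ('i \<Rightarrow> 'k::field) set set \<Rightarrow> nat \<Rightarrow> ((('i \<Rightarrow> 'k) \<Rightarrow> 'k) \<Rightarrow> 'k) set set" where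
  "linear_system_image I X d =
     {fvec.span {evaluation (global_sections I X d) v} | v. v \<in> cone X}"

end

theory Submission
  imports Defs
begin

text \<open>
  Let \<open>V\<close> be the space of vectors with coordinates \<open>0, \<dots>, n\<close>. A quadric \<open>Q\<close> in the Veronese space is a
  quadratic form on the symmetric square of \<open>V\<close>, hence, with its polar form \<open>B\<close>, a four-linear form
  \<open>T(a, b; c, d) = B(ab, cd)\<close> on \<open>V\<close>. It contains the Veronese variety iff \<open>T(v, v; v, v) = 0\<close> for all
  \<open>v\<close>, and polarising this condition gives the first Bianchi identity
  \<open>T(a, b; c, d) + T(a, c; b, d) + T(a, d; c, b) = 0\<close> (\<open>bianchi\<close>). So \<open>T\<close> is an algebraic curvature tensor in
  symmetric form, and \<open>T(a, b; c, d) - T(a, d; c, b)\<close> is its antisymmetric form, a quadratic expression in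
  bivectors. Passing between the two forms and back multiplies by \<open>3\<close>, so nothing is lost.

  For linear forms \<open>a\<close> and \<open>b\<close>, let \<open>[ab]\<close> be their product, as a linear form on the Veronese space. The
  pencil quadric \<open>[aa][bb] - [ab]\<^sup>2\<close> contains the Veronese variety, and its antisymmetric form is a multiple
  of the square of \<open>a \<and> b\<close> (\<open>curvature_pencil_quadric\<close>). By the Bianchi identity, pencil quadrics span all
  quadrics containing the Veronese variety (\<open>veronese_ideal_2_eq_span\<close>), and taking antisymmetric forms is an
  injective linear map on these (\<open>bivector_of_eq_0\<close>). So this map identifies the ideal in degree two with
  the span of the second Veronese embedding of the Pluecker embedding.

  Under this map, the Veronese image of the Grassmannian corresponds to the set of pencil quadrics. These are
  the elements of rank at most three: such an element is \<open>xy - z\<^sup>2\<close> with linear forms \<open>x\<close>, \<open>y\<close>, \<open>z\<close>, which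
  are quadratic forms on \<open>V\<close> with \<open>xy = z\<^sup>2\<close>. Factorisation leaves the case that they are proportional and
  the quadric is zero, and the case \<open>x = a\<^sup>2\<close>, \<open>y = b\<^sup>2\<close>, \<open>z = \<plusminus>ab\<close>
  (\<open>quadratic_product_eq_square\<close>, \<open>rank_3_quadric_in_ideal_is_pencil_quadric\<close>).

  For the complete linear system one needs that each section \<open>s\<close> of \<open>O(2)\<close> on the Grassmannian is the
  restriction of a quadric. On a line contained in the Grassmannian, \<open>s\<close> is a binary quadratic form
  (\<open>global_section_quadratic_on_line\<close>), so \<open>s(u \<and> v)\<close> is quadratic on each plane in \<open>u\<close> and in \<open>v\<close>, hence
  biquadratic by the parallelogram law. It vanishes for \<open>u = v\<close>, so its polarisation is again a curvature
  tensor, and the Bianchi identity expresses \<open>12 s\<close> as a quadratic form in the minors of \<open>u\<close> and \<open>v\<close>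
  (\<open>biquadratic_eq_quadric_in_minors\<close>). Then the dual of the space of sections is the span of the Veronese
  image, by duality of finite-dimensional spaces (\<open>bij_betw_pairing_functional\<close>).
\<close>

section \<open>The base field\<close>

lemma two_neq_0_if_CHAR:
  assumes "CHAR('k::idom) \<noteq> 2" shows "(2::'k) \<noteq> 0"
proof
  assume "(2::'k) = 0"
  then have "CHAR('k) dvd 2"
    using of_nat_eq_0_iff_char_dvd[where ?'a='k and n=2] by simp
  then have "CHAR('k) = 1 \<or> CHAR('k) = 2"
    using primes_dvd_imp_eq two_is_prime_nat by (metis prime_nat_iff)
  then show False using assms by simp
qed

lemma three_neq_0_if_CHAR:
  assumes "CHAR('k::idom) \<noteq> 3" shows "(3::'k) \<noteq> 0"
proof
  assume "(3::'k) = 0"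
  then have "CHAR('k) dvd 3"
    using of_nat_eq_0_iff_char_dvd[where ?'a='k and n=3] by simp
  moreover have "prime (3::nat)" by simp
  ultimately have "CHAR('k) = 1 \<or> CHAR('k) = 3"
    by (metis prime_nat_iff)
  then show False using assms by simp
qed

text \<open>
  Over a finite field, one plus the product of all linear factors \<open>X - x\<close> has no root.
\<close>

lemma infinite_UNIV_alg_closed: "infinite (UNIV :: 'k::alg_closed_field set)"
proof
  assume fin: "finite (UNIV :: 'k set)"
  define p where "p = (\<Prod>x\<in>(UNIV::'k set). [:-x, 1:]) + 1"
  have one: "poly p y = 1" for y
    using fin by (auto simp: p_def poly_prod prod_zero_iff)
  have "degree (\<Prod>x\<in>(UNIV::'k set). [:-x, 1:]) = card (UNIV::'k set)"
    by (subst degree_prod_eq_sum_degree) auto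
  moreover have "card (UNIV::'k set) > 0" using fin by (simp add: card_gt_0_iff)
  ultimately have "degree p > 0" unfolding p_def by (subst degree_add_eq_left) auto
  then obtain y where "poly p y = 0" using alg_closed_imp_poly_has_root by blast
  with one show False by simp
qed

text \<open>
  Since \<open>h\<close> has finitely many zeros, identities between polynomials in one variable may be checked
  where a given denominator does not vanish.
\<close>

lemma poly_eq_0_cofinite:
  fixes p h :: "'k::alg_closed_field poly"
  assumes "h \<noteq> 0" and "\<And>t. poly h t \<noteq> 0 \<Longrightarrow> poly p t = 0"
  shows "p = 0"
proof -
  have "poly (p * h) t = 0" for t using assms(2) by auto
  then have "{t. poly (p * h) t = 0} = UNIV" by auto
  then have "p * h = 0" using poly_roots_finite[of "p * h"] infinite_UNIV_alg_closed by auto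
  with assms(1) show ?thesis by simp
qed

section \<open>Evaluation of polynomials, forms\<close>

lemma peval_superset:
  assumes "finite M" "Poly_Mapping.keys p \<subseteq> M"
  shows "peval p v = (\<Sum>m\<in>M. Poly_Mapping.lookup p m * (\<Prod>i\<in>#m. v i))"
  unfolding peval_def using assms
  by (intro sum.mono_neutral_left) (auto simp: in_keys_iff)

lemma peval_add: "peval (p + q) v = peval p v + peval q v"
proof -
  let ?M = "Poly_Mapping.keys p \<union> Poly_Mapping.keys q"
  have "Poly_Mapping.keys (p + q) \<subseteq> ?M" by (rule keys_add)
  then show ?thesis
    by (simp add: peval_superset[of ?M] lookup_add algebra_simps sum.distrib)
qed

lemma keys_pscale: "Poly_Mapping.keys (pscale c p) \<subseteq> Poly_Mapping.keys p"
  by (auto simp: in_keys_iff)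

lemma peval_pscale: "peval (pscale c p) v = c * peval p v"
  by (subst peval_superset[OF finite_keys keys_pscale])
    (simp add: peval_def sum_distrib_left mult.assoc)

lemma peval_0 [simp]: "peval 0 v = 0"
  by (simp add: peval_def)

lemma peval_uminus: "peval (- p) v = - peval (p :: ('i,'k::comm_ring_1) mpol) v"
  using peval_add[of p "- p" v] by (simp add: eq_neg_iff_add_eq_0 add.commute)

lemma peval_diff: "peval (p - q) v = peval p v - peval (q :: ('i,'k::comm_ring_1) mpol) v"
  using peval_add[of p "- q" v] by (simp add: peval_uminus)

lemma peval_sum: "peval (sum f A) v = (\<Sum>a\<in>A. peval (f a) v)"
  by (induction A rule: infinite_finite_induct) (auto simp: peval_add)

lemma peval_single: "peval (Poly_Mapping.single m c) v = c * (\<Prod>i\<in>#m. v i)"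
  by (subst peval_superset[of "{m}"]) auto

lemma mpol_sum_single: "p = (\<Sum>m\<in>Poly_Mapping.keys p. Poly_Mapping.single m (Poly_Mapping.lookup p m))"
  by (rule poly_mapping_eqI) (auto simp: lookup_sum lookup_single when_def in_keys_iff sum.delta)

lemma peval_mult: "peval (p * q) v = peval p v * peval q v"
proof -
  have 1: "peval (Poly_Mapping.single m c * q) v = c * (\<Prod>i\<in>#m. v i) * peval q v" for m c
  proof -
    have "Poly_Mapping.single m c * q =
        (\<Sum>m'\<in>Poly_Mapping.keys q. Poly_Mapping.single (m + m') (c * Poly_Mapping.lookup q m'))"
      by (subst mpol_sum_single[of q]) (simp add: sum_distrib_left mult_single)
    then show ?thesis
      by (simp only: peval_sum peval_single peval_def[of q] sum_distrib_left image_mset_union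
          prod_mset_Un mult_ac)
  qed
  have "p * q = (\<Sum>m\<in>Poly_Mapping.keys p.
      Poly_Mapping.single m (Poly_Mapping.lookup p m) * q)"
    by (subst mpol_sum_single[of p]) (simp add: sum_distrib_right)
  then show ?thesis
    by (simp only: peval_sum 1 peval_def[of p] sum_distrib_right)
qed

lemma peval_power: "peval (p ^ k) v = peval p v ^ k"
  by (induction k) (auto simp: peval_mult peval_single simp flip: single_one)

lemma forms_0 [simp]: "0 \<in> forms I d"
  by (simp add: forms_def)

lemma forms_add: "p \<in> forms I d \<Longrightarrow> q \<in> forms I d \<Longrightarrow> p + q \<in> forms I d"
  using keys_add[of p q] by (auto simp: forms_def)

lemma forms_pscale: "p \<in> forms I d \<Longrightarrow> pscale c p \<in> forms I d"
  using keys_pscale[of c p] by (auto simp: forms_def)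

lemma forms_diff: "p \<in> forms I d \<Longrightarrow> q \<in> forms I d \<Longrightarrow> p - q \<in> forms I d"
  for p q :: "('i, 'k::ab_group_add) mpol"
  using keys_diff[of p q] by (auto simp: forms_def)

lemma forms_sum: "(\<And>a. a \<in> A \<Longrightarrow> f a \<in> forms I d) \<Longrightarrow> sum f A \<in> forms I d"
  by (induction A rule: infinite_finite_induct) (auto simp: forms_add)

lemma forms_single: "m \<in> multisets_of_size I d \<Longrightarrow> Poly_Mapping.single m c \<in> forms I d"
  by (auto simp: forms_def)

lemma forms_mult: "p \<in> forms I d \<Longrightarrow> q \<in> forms I e \<Longrightarrow> p * q \<in> forms I (d + e)"
  using keys_mult[of p q] by (fastforce simp: forms_def multisets_of_size_def)

lemma pscale_mult_left: "pscale c p * q = pscale c (p * q)"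
  by (simp add: pscale_def mult_map_scale_conv_mult mult.assoc)

lemma pscale_mult_right: "p * pscale c q = pscale c (p * q)"
  by (metis mult.commute pscale_mult_left)

lemma prod_mset_scale: "(\<Prod>i\<in>#m. c * v i) = c ^ size m * (\<Prod>i\<in>#m. v i :: 'k::comm_semiring_1)"
  by (induction m) (auto simp: mult_ac)

lemma peval_fscale:
  assumes "p \<in> forms I d" shows "peval p (fscale c v) = c ^ d * peval p v"
proof -
  have "size m = d" if "m \<in> Poly_Mapping.keys p" for m
    using assms that by (auto simp: forms_def multisets_of_size_def)
  then show ?thesis
    by (simp add: peval_def fscale_def prod_mset_scale sum_distrib_left mult_ac)
qed

lemma mem_multisets_of_size_2: "m \<in> multisets_of_size A 2 \<longleftrightarrow> (\<exists>i\<in>A. \<exists>j\<in>A. m = {#i, j#})"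
  proof
  assume m: "m \<in> multisets_of_size A 2"
  then have "size m = Suc 1" by (simp add: multisets_of_size_def)
  then obtain i N where "m = add_mset i N" "size N = 1"
    using size_eq_Suc_imp_eq_union by fastforce
  then obtain j where "m = {#i, j#}" using size_1_singleton_mset[of N] by auto
  then show "\<exists>i\<in>A. \<exists>j\<in>A. m = {#i, j#}"
    using m by (intro bexI[of _ i] bexI[of _ j]) (auto simp: multisets_of_size_def)
qed (auto simp: multisets_of_size_def)

lemma mem_multisets_of_size_1: "m \<in> multisets_of_size A 1 \<longleftrightarrow> (\<exists>i\<in>A. m = {#i#})"
  using size_1_singleton_mset[of m] by (auto simp: multisets_of_size_def)

section \<open>Quadratic functions\<close>

lemma fscale_add: "fscale c (v + w) = fscale c v + fscale (c::'k::field) w"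
  by (simp add: fscale_def fun_eq_iff algebra_simps)

lemma fscale_0_left [simp]: "fscale (0::'k::field) v = 0"
  by (simp add: fscale_def fun_eq_iff)

lemma fscale_1 [simp]: "fscale (1::'k::field) v = v"
  by (simp add: fscale_def)

lemma fscale_apply: "fscale c f x = c * f x"
  by (simp add: fscale_def)

lemma fscale_fscale [simp]: "fscale a (fscale b v) = fscale ((a::'k::field) * b) v"
  by (simp add: fscale_def mult.assoc)

definition polar :: "(('a \<Rightarrow> 'k::field) \<Rightarrow> 'k) \<Rightarrow> ('a \<Rightarrow> 'k) \<Rightarrow> ('a \<Rightarrow> 'k) \<Rightarrow> 'k" where
  "polar q v w = q (v + w) - q v - q w"

lemma polar_commute: "polar q v w = polar q w v"
  by (simp add: polar_def add.commute)

text \<open>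
  Quadratic forms without coordinates. As the polar form is symmetric, linearity in its first
  argument makes it bilinear.
\<close>

definition quadratic :: "(('a \<Rightarrow> 'k::field) \<Rightarrow> 'k) \<Rightarrow> bool" where
  "quadratic q \<longleftrightarrow> (\<forall>c v. q (fscale c v) = c\<^sup>2 * q v) \<and>
     (\<forall>u v w. polar q (u + v) w = polar q u w + polar q v w) \<and>
     (\<forall>c v w. polar q (fscale c v) w = c * polar q v w)"

definition linear_functional :: "(('a \<Rightarrow> 'k::field) \<Rightarrow> 'k) \<Rightarrow> bool" where
  "linear_functional a \<longleftrightarrow> (\<forall>u v. a (u + v) = a u + a v) \<and> (\<forall>c v. a (fscale c v) = c * a v)"

lemma quadratic_scale: "quadratic q \<Longrightarrow> q (fscale c v) = c\<^sup>2 * q v"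
  by (simp add: quadratic_def)

lemma quadratic_add: "q (v + w) = q v + polar q v w + q w"
  by (simp add: polar_def)

lemma quadratic_combination:
  assumes "quadratic q"
  shows "q (fscale x v + fscale y w) = x\<^sup>2 * q v + x * y * polar q v w + y\<^sup>2 * q w"
proof -
  have "polar q (fscale x v) (fscale y w) = x * (y * polar q v w)"
    using assms polar_commute[of q] by (metis quadratic_def)
  then show ?thesis
    by (simp add: quadratic_add[of q "fscale x v"] quadratic_scale[OF assms])
qed

text \<open>
  The argument of Jordan and von Neumann: on planes the function satisfies the parallelogram law, and
  four instances of this law combine to the additivity of the polar form.
\<close>

lemma quadratic_if_quadratic_on_planes:
  fixes f :: "('a \<Rightarrow> 'k::field) \<Rightarrow> 'k"
  assumes two: "(2::'k) \<noteq> 0"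
    and planes: "\<And>v w. \<exists>a b c. \<forall>x y. f (fscale x v + fscale y w) = a * x\<^sup>2 + b * x * y + c * y\<^sup>2"
  shows "quadratic f"
proof -
  have plane: "\<exists>b. \<forall>x y. f (fscale x v + fscale y w) = f v * x\<^sup>2 + b * x * y + f w * y\<^sup>2" for v w
  proof -
    obtain a b c where abc: "\<And>x y. f (fscale x v + fscale y w) = a * x\<^sup>2 + b * x * y + c * y\<^sup>2"
      using planes by metis
    from abc[of 1 0] abc[of 0 1] have "f v = a" "f w = c" by simp_all
    with abc show ?thesis by metis
  qed
  have sc: "f (fscale c v) = c\<^sup>2 * f v" for c v
    using plane[of v v] by (metis (no_types, opaque_lifting) add.right_neutral fscale_0_left mult.commute mult_zero_left mult_zero_right power_zero_numeral)
  have par: "f (v + w) + f (v - w) = 2 * f v + 2 * f w" for v w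
  proof -
    obtain b where b: "\<And>x y. f (fscale x v + fscale y w) = f v * x\<^sup>2 + b * x * y + f w * y\<^sup>2"
      using plane by metis
    have "fscale (-1) w = - w" by (simp add: fscale_def fun_eq_iff)
    with b[of 1 1] b[of 1 "-1"] show ?thesis by simp
  qed
  have "polar f (u + v) w = polar f u w + polar f v w" for u v w
  proof -
    have 1: "f (u + v + w) + f (u + v - w) = 2 * f (u + v) + 2 * f w" by (rule par)
    have 2: "f (u + v - w) + f (u - (v + w)) = 2 * f (u - w) + 2 * f v"
      using par[of "u - w" v] by (simp add: algebra_simps)
    have 3: "f (u + v + w) + f (u - (v + w)) = 2 * f u + 2 * f (v + w)"
      using par[of u "v + w"] by (simp add: algebra_simps)
    have 4: "f (u - w) = 2 * f u + 2 * f w - f (u + w)"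
      using par[of u w] by (simp add: algebra_simps)
    have "2 * f (u + v + w) = (f (u + v + w) + f (u + v - w))
        - (f (u + v - w) + f (u - (v + w))) + (f (u + v + w) + f (u - (v + w)))"
      by (simp add: algebra_simps)
    also have "\<dots> = 2 * (f (u + v) + f (u + w) + f (v + w) - f u - f v - f w)"
      unfolding 1 2 3 4 by (simp add: algebra_simps)
    finally have "f (u + v + w) = f (u + v) + f (u + w) + f (v + w) - f u - f v - f w"
      using two by (simp only: mult_cancel_left simp_thms)
    then show ?thesis by (simp add: polar_def algebra_simps)
  qed
  moreover have "polar f (fscale c v) w = c * polar f v w" for c v w
  proof -
    obtain b where b: "\<And>x y. f (fscale x v + fscale y w) = f v * x\<^sup>2 + b * x * y + f w * y\<^sup>2"
      using plane by metis
    show ?thesis using b[of 1 1] b[of c 1] sc by (simp add: polar_def algebra_simps)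
  qed
  ultimately show ?thesis using sc by (simp add: quadratic_def)
qed

section \<open>Functions that are polynomial on lines\<close>

text \<open>
  Two nonzero functions of this kind have a common line on which neither vanishes identically, so that
  their product is nonzero. This stands in for the polynomial ring in several variables being a domain.
\<close>

definition polynomial_on_lines :: "(('a \<Rightarrow> 'k::field) \<Rightarrow> 'k) \<Rightarrow> bool" where
  "polynomial_on_lines f \<longleftrightarrow> (\<forall>u w. \<exists>p. \<forall>t. f (u + fscale t w) = poly p t)"

lemma polynomial_on_lines_no_zero_divisors:
  fixes f g :: "('a \<Rightarrow> 'k::alg_closed_field) \<Rightarrow> 'k"
  assumes "polynomial_on_lines f" "polynomial_on_lines g" and "\<And>v. f v * g v = 0"
  shows "(\<forall>v. f v = 0) \<or> (\<forall>v. g v = 0)"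
proof (rule ccontr)
  assume "\<not> ?thesis"
  then obtain u w where u: "f u \<noteq> 0" and w: "g w \<noteq> 0" by auto
  obtain p where p: "\<And>t. f (u + fscale t (w - u)) = poly p t"
    using assms(1) unfolding polynomial_on_lines_def by metis
  obtain q where q: "\<And>t. g (u + fscale t (w - u)) = poly q t"
    using assms(2) unfolding polynomial_on_lines_def by metis
  have "poly p 0 \<noteq> 0" "poly q 1 \<noteq> 0"
    using p[of 0] q[of 1] u w by simp_all
  then have "p \<noteq> 0" "q \<noteq> 0" by auto
  moreover have "poly (p * q) t = 0" for t using assms(3) p q by (metis poly_mult)
  then have "p * q = 0" by (intro poly_eq_0_cofinite[of 1]) auto
  ultimately show False by simp
qed

lemma polynomial_on_lines_quadratic: "quadratic q \<Longrightarrow> polynomial_on_lines q"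
  unfolding polynomial_on_lines_def
proof (intro allI)
  fix u w assume "quadratic q"
  then have "q (u + fscale t w) = poly [:q u, polar q u w, q w:] t" for t
    using quadratic_combination[of q 1 u t w] by (simp add: algebra_simps power2_eq_square)
  then show "\<exists>p. \<forall>t. q (u + fscale t w) = poly p t" by blast
qed

lemma polynomial_on_lines_linear: "linear_functional a \<Longrightarrow> polynomial_on_lines a"
  unfolding polynomial_on_lines_def
proof (intro allI)
  fix u w assume "linear_functional a"
  then have "a (u + fscale t w) = poly [:a u, a w:] t" for t
    by (simp add: linear_functional_def)
  then show "\<exists>p. \<forall>t. a (u + fscale t w) = poly p t" by blast
qed

lemma polynomial_on_lines_mult:
  "polynomial_on_lines f \<Longrightarrow> polynomial_on_lines g \<Longrightarrow> polynomial_on_lines (\<lambda>v. f v * g v)"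
  unfolding polynomial_on_lines_def by (metis poly_mult)

lemma polynomial_on_lines_diff:
  "polynomial_on_lines f \<Longrightarrow> polynomial_on_lines g \<Longrightarrow> polynomial_on_lines (\<lambda>v. f v - g v)"
  unfolding polynomial_on_lines_def by (metis poly_diff)

lemma polynomial_on_lines_add:
  "polynomial_on_lines f \<Longrightarrow> polynomial_on_lines g \<Longrightarrow> polynomial_on_lines (\<lambda>v. f v + g v)"
  unfolding polynomial_on_lines_def by (metis poly_add)

lemma polynomial_on_lines_cmult:
  "polynomial_on_lines f \<Longrightarrow> polynomial_on_lines (\<lambda>v. c * f v)"
  unfolding polynomial_on_lines_def by (metis poly_smult)

lemma polynomial_on_lines_compose:
  assumes "polynomial_on_lines f" "\<And>u t w. \<pi> (u + fscale t w) = \<pi> u + fscale t (\<pi> w)"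
  shows "polynomial_on_lines (\<lambda>v. f (\<pi> v))"
  using assms unfolding polynomial_on_lines_def by metis

text \<open>
  An instance of unique factorisation: a prime factor of \<open>q\<^sub>1\<close> of odd multiplicity also divides \<open>q\<^sub>2\<close> and
  \<open>q\<^sub>3\<close>, which leaves room only for a proportionality. The proof avoids factorisation.
  Completing the square gives \<open>q\<^sub>1 = c (t\<^sup>2 - r)\<close>, where \<open>t\<close> is a linear functional and \<open>r\<close> lives on a complementary hyperplane. If \<open>r = 0\<close>, then \<open>q\<^sub>1\<close> is a square. Otherwise division of \<open>q\<^sub>3\<close> by
  \<open>q\<^sub>1\<close> with respect to \<open>t\<close> leaves a remainder \<open>\<beta> t + \<gamma>\<close>, which vanishes at both square roots of \<open>r\<close>,
  hence identically.
\<close>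

lemma quadratic_product_eq_square:
  fixes q\<^sub>1 q\<^sub>2 q\<^sub>3 :: "('a \<Rightarrow> 'k::alg_closed_field) \<Rightarrow> 'k"
  assumes two: "(2::'k) \<noteq> 0"
    and q1: "quadratic q\<^sub>1" and q2: "quadratic q\<^sub>2" and q3: "quadratic q\<^sub>3"
    and eq: "\<And>v. q\<^sub>1 v * q\<^sub>2 v = (q\<^sub>3 v)\<^sup>2"
  shows "(\<exists>a. linear_functional a \<and> (\<forall>v. q\<^sub>1 v = (a v)\<^sup>2)) \<or>
    (\<exists>\<alpha>. \<forall>v. q\<^sub>3 v = \<alpha> * q\<^sub>1 v \<and> q\<^sub>2 v = \<alpha>\<^sup>2 * q\<^sub>1 v)"
proof (cases "\<forall>v. q\<^sub>1 v = 0")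
  case True
  then show ?thesis by (intro disjI1 exI[of _ "\<lambda>_. 0"]) (auto simp: linear_functional_def)
next
  case False
  then obtain e where e: "q\<^sub>1 e \<noteq> 0" by blast
  define c where "c = q\<^sub>1 e"
  \<comment> \<open>\<open>\<pi>\<close> is the projection along \<open>e\<close> to the hyperplane orthogonal to \<open>e\<close>, and \<open>t\<close> is the coordinate
      along \<open>e\<close>.\<close>
  define t where "t w = polar q\<^sub>1 w e / (2 * c)" for w
  define \<pi> where "\<pi> w = w - fscale (t w) e" for w
  have c0: "c \<noteq> 0" using e by (simp add: c_def)
  have t: "linear_functional t"
    using q1 by (simp add: linear_functional_def t_def quadratic_def add_divide_distrib)
  have \<pi>_line: "\<pi> (u + fscale s w) = \<pi> u + fscale s (\<pi> w)" for u s w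
    using t by (simp add: \<pi>_def linear_functional_def fscale_def fun_eq_iff algebra_simps)
  have decomp: "w = fscale (t w) e + fscale 1 (\<pi> w)" for w by (simp add: \<pi>_def)
  have "e + e = fscale 2 e" by (simp add: fscale_def fun_eq_iff)
  then have "polar q\<^sub>1 e e = 2 * c"
    using quadratic_scale[OF q1, of 2 e] by (simp add: polar_def c_def)
  have orth: "polar q\<^sub>1 e (\<pi> w) = 0" for w
  proof -
    have "polar q\<^sub>1 w e = polar q\<^sub>1 (fscale (t w) e + \<pi> w) e" by (simp add: \<pi>_def)
    also have "\<dots> = t w * polar q\<^sub>1 e e + polar q\<^sub>1 (\<pi> w) e" using q1 by (simp add: quadratic_def)
    finally show ?thesis using \<open>polar q\<^sub>1 e e = 2 * c\<close> c0 two
      by (simp add: t_def polar_commute)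
  qed
  define r where "r w = - q\<^sub>1 (\<pi> w) / c" for w
  have q1_e: "q\<^sub>1 (fscale x e + \<pi> w) = c * (x\<^sup>2 - r w)" for x w
    using quadratic_combination[OF q1, of x e 1 "\<pi> w"] orth c0
    by (simp add: r_def c_def algebra_simps)
  have q1_t: "q\<^sub>1 w = c * ((t w)\<^sup>2 - r w)" for w
    using q1_e[of "t w" w] decomp[of w] by simp
  show ?thesis
  proof (cases "\<forall>w. r w = 0")
    case True
    obtain d where "d\<^sup>2 = c" using nth_root_exists[of 2 c] by auto
    then have "q\<^sub>1 w = (d * t w)\<^sup>2" for w using q1_t True by (simp add: power_mult_distrib)
    moreover have "linear_functional (\<lambda>w. d * t w)"
      using t by (simp add: linear_functional_def algebra_simps)
    ultimately show ?thesis by blast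
  next
    case False
    \<comment> \<open>The quotient \<open>\<alpha>\<close> and the coefficients of the remainder in the division by \<open>q\<^sub>1\<close>.\<close>
    define \<alpha> where "\<alpha> = q\<^sub>3 e / c"
    define \<beta> where "\<beta> w = polar q\<^sub>3 (\<pi> w) e" for w
    define \<gamma> where "\<gamma> w = q\<^sub>3 (\<pi> w) - \<alpha> * q\<^sub>1 (\<pi> w)" for w
    have q3_e: "q\<^sub>3 (fscale x e + \<pi> w) = \<alpha> * q\<^sub>1 (fscale x e + \<pi> w) + x * \<beta> w + \<gamma> w" for x w
      unfolding q1_e using quadratic_combination[OF q3, of x e 1 "\<pi> w"] c0
      by (simp add: \<alpha>_def \<beta>_def \<gamma>_def r_def polar_commute algebra_simps)
    have root: "x * \<beta> w + \<gamma> w = 0" if "x\<^sup>2 = r w" for x w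
      using q3_e[of x w] q1_e[of x w] eq[of "fscale x e + \<pi> w"] that by simp
    have both: "\<gamma> w = 0 \<and> (\<beta> w)\<^sup>2 * r w = 0" for w
    proof -
      \<comment> \<open>Both \<open>x\<close> and \<open>- x\<close> are zeros of the remainder; their sum isolates \<open>\<gamma>\<close>.\<close>
      obtain x where x: "x\<^sup>2 = r w" using nth_root_exists[of 2 "r w"] by auto
      have 1: "x * \<beta> w + \<gamma> w = 0" by (rule root[OF x])
      have 2: "(- x) * \<beta> w + \<gamma> w = 0" by (rule root) (simp add: x)
      have "2 * \<gamma> w = (x * \<beta> w + \<gamma> w) + ((- x) * \<beta> w + \<gamma> w)" by simp
      also have "\<dots> = 0" unfolding 1 2 by simp
      finally have "2 * \<gamma> w = 0" .
      then have "\<gamma> w = 0" using two by simp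
      with 1 have "x * \<beta> w = 0" by simp
      then have "(\<beta> w)\<^sup>2 * x\<^sup>2 = 0" by auto
      with \<open>\<gamma> w = 0\<close> x show ?thesis by simp
    qed
    have lin: "linear_functional (\<lambda>v. polar q\<^sub>3 v e)"
      using q3 by (simp add: quadratic_def linear_functional_def)
    have \<beta>_line: "polynomial_on_lines \<beta>"
      unfolding \<beta>_def
      by (rule polynomial_on_lines_compose[OF polynomial_on_lines_linear[OF lin] \<pi>_line])
    have "polynomial_on_lines (\<lambda>w. (- 1 / c) * q\<^sub>1 (\<pi> w))"
      by (intro polynomial_on_lines_cmult
          polynomial_on_lines_compose[OF polynomial_on_lines_quadratic[OF q1] \<pi>_line])
    then have "polynomial_on_lines r" by (simp add: r_def[abs_def])
    then have "\<forall>w. \<beta> w * \<beta> w = 0"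
      using polynomial_on_lines_no_zero_divisors[OF polynomial_on_lines_mult[OF \<beta>_line \<beta>_line], of r]
        both False by (simp add: power2_eq_square)
    then have "q\<^sub>3 w = \<alpha> * q\<^sub>1 w" for w
      using q3_e[of "t w" w] decomp[of w] both by simp
    moreover have "q\<^sub>2 v = \<alpha>\<^sup>2 * q\<^sub>1 v" for v
    proof -
      have "q\<^sub>1 v * (q\<^sub>2 v - \<alpha>\<^sup>2 * q\<^sub>1 v) = 0" for v
        using eq[of v] \<open>\<And>w. q\<^sub>3 w = \<alpha> * q\<^sub>1 w\<close> by (simp add: algebra_simps power2_eq_square)
      then have "(\<forall>v. q\<^sub>1 v = 0) \<or> (\<forall>v. q\<^sub>2 v - \<alpha>\<^sup>2 * q\<^sub>1 v = 0)"
        by (intro polynomial_on_lines_no_zero_divisors polynomial_on_lines_diff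
            polynomial_on_lines_cmult polynomial_on_lines_quadratic q1 q2)
      with e show ?thesis by (metis eq_iff_diff_eq_0)
    qed
    ultimately show ?thesis by blast
  qed
qed

section \<open>Curvature forms\<close>

text \<open>
  The model is \<open>T(a, b; c, d) = B(ab, cd)\<close> for the polar form \<open>B\<close> of a quadratic form on the symmetric
  square of a vector space that vanishes at every square \<open>vv\<close>. Such tensors are algebraic curvature
  tensors in their symmetric guise: \<open>T(a, b; c, d) - T(a, d; c, b)\<close> has the symmetries of a Riemann
  tensor in the pairs \<open>(a, c)\<close> and \<open>(b, d)\<close>.
\<close>

locale curvature_form =
  fixes T :: "('a \<Rightarrow> 'k::field) \<Rightarrow> ('a \<Rightarrow> 'k) \<Rightarrow> ('a \<Rightarrow> 'k) \<Rightarrow> ('a \<Rightarrow> 'k) \<Rightarrow> 'k"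
  assumes two: "(2::'k) \<noteq> 0"
    and add1: "T (a + a') b c d = T a b c d + T a' b c d"
    and scale1: "T (fscale x a) b c d = x * T a b c d"
    and sym1: "T b a c d = T a b c d"
    and pair: "T c d a b = T a b c d"
    and null: "T a a a a = 0"
begin

lemma sym2: "T a b d c = T a b c d"
  using sym1 pair by metis

lemma add2: "T a (b + b') c d = T a b c d + T a b' c d"
  and add3: "T a b (c + c') d = T a b c d + T a b c' d"
  and add4: "T a b c (d + d') = T a b c d + T a b c d'"
  using add1 sym1 sym2 pair by metis+

lemma scale2: "T a (fscale x b) c d = x * T a b c d"
  and scale3: "T a b (fscale x c) d = x * T a b c d"
  and scale4: "T a b c (fscale x d) = x * T a b c d"
  using scale1 sym1 sym2 pair by metis+

lemma sum1: "T (\<Sum>i\<in>I. fscale (x i) (f i)) b c d = (\<Sum>i\<in>I. x i * T (f i) b c d)"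
proof (induction I rule: infinite_finite_induct)
  case empty
  then show ?case using scale1[of 0 0 b c d] by (simp only: sum.empty fscale_0_left mult_zero_left)
next
  case (infinite A)
  then show ?case using scale1[of 0 0 b c d] by (simp add: zero_fun_def)
next
  case (insert i I)
  then show ?case by (simp only: sum.insert not_False_eq_True add1 scale1)
qed

lemma sum2: "T a (\<Sum>i\<in>I. fscale (x i) (f i)) c d = (\<Sum>i\<in>I. x i * T a (f i) c d)"
  and sum3: "T a b (\<Sum>i\<in>I. fscale (x i) (f i)) d = (\<Sum>i\<in>I. x i * T a b (f i) d)"
  and sum4: "T a b c (\<Sum>i\<in>I. fscale (x i) (f i)) = (\<Sum>i\<in>I. x i * T a b c (f i))"
  by (metis (no_types, lifting) sum1 sym1 sym2 pair sum.cong)+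

text \<open>
  The part of the nullity condition at \<open>a + b\<close> that is even in \<open>b\<close>, isolated by adding the condition at
  \<open>a - b\<close>.
\<close>

lemma bianchi_repeated: "T a a b b + 2 * T a b a b = 0"
proof -
  have m: "T (a + b) (a + b) (a + b) (a + b)
      + T (a + fscale (-1) b) (a + fscale (-1) b) (a + fscale (-1) b) (a + fscale (-1) b)
      = 2 * T a a a a + 2 * T b b b b + 4 * (T a a b b + 2 * T a b a b)"
    unfolding add1 add2 add3 add4 scale1 scale2 scale3 scale4
    using sym1[of b a] sym2[of _ _ b a] pair[of b b a a] by (simp add: algebra_simps)
  have "(4::'k) = 2 * 2" by simp
  then have "(4::'k) \<noteq> 0" using two by (metis mult_eq_0_iff)
  moreover have "4 * (T a a b b + 2 * T a b a b) = 0"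
    using m by (simp only: null mult_zero_right add_0_left)
  ultimately show ?thesis by (simp only: mult_eq_0_iff simp_thms)
qed

text \<open>
  The first Bianchi identity arises by polarising the previous identity first in \<open>a\<close> and then in \<open>b\<close>.
\<close>

lemma bianchi: "T a b c d + T a c b d + T a d c b = 0"
proof -
  have 1: "T a c b b + 2 * T a b c b = 0" for a b c
  proof -
    have "2 * (T a c b b + 2 * T a b c b) =
        (T (a + c) (a + c) b b + 2 * T (a + c) b (a + c) b)
        - (T a a b b + 2 * T a b a b) - (T c c b b + 2 * T c b c b)"
      unfolding add1 add2 add3 add4 using sym1[of c a b b] pair[of a b c b]
      by (simp add: algebra_simps)
    also have "\<dots> = 0" by (simp only: bianchi_repeated diff_zero)
    finally show ?thesis using two by (simp only: mult_eq_0_iff simp_thms)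
  qed
  have "2 * (T a c b d + T a b c d + T a d c b) =
      (T a c (b + d) (b + d) + 2 * T a (b + d) c (b + d))
      - (T a c b b + 2 * T a b c b) - (T a c d d + 2 * T a d c d)"
    unfolding add1 add2 add3 add4 using sym2[of a c d b] by (simp add: algebra_simps)
  also have "\<dots> = 0" by (simp only: 1 diff_zero)
  finally have "T a c b d + T a b c d + T a d c b = 0"
    using two by (simp only: mult_eq_0_iff simp_thms)
  then show ?thesis by (simp only: add.commute[of "T a c b d"])
qed

end

section \<open>Sections of O(2) along a line\<close>

text \<open>
  Regular functions on the affine line are polynomials.
\<close>

lemma locally_fraction_imp_polynomial:
  fixes \<sigma> :: "'k::alg_closed_field \<Rightarrow> 'k"
  assumes loc: "\<And>t\<^sub>0. \<exists>h f g. poly h t\<^sub>0 \<noteq> 0 \<and>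
      (\<forall>t. poly h t \<noteq> 0 \<longrightarrow> poly g t \<noteq> 0 \<and> \<sigma> t = poly f t / poly g t)"
  shows "\<exists>P. \<forall>t. \<sigma> t = poly P t"
proof -
  define fraction where "fraction f g \<longleftrightarrow> g \<noteq> 0 \<and>
      (\<exists>h. h \<noteq> 0 \<and> (\<forall>t. poly h t \<noteq> 0 \<longrightarrow> \<sigma> t * poly g t = poly f t))" for f g
  have cross: "f * g' = f' * g" if "fraction f g" "fraction f' g'" for f g f' g'
  proof -
    obtain h where h: "h \<noteq> 0" "\<And>t. poly h t \<noteq> 0 \<Longrightarrow> \<sigma> t * poly g t = poly f t"
      using \<open>fraction f g\<close> unfolding fraction_def by blast
    obtain h' where h': "h' \<noteq> 0" "\<And>t. poly h' t \<noteq> 0 \<Longrightarrow> \<sigma> t * poly g' t = poly f' t"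
      using \<open>fraction f' g'\<close> unfolding fraction_def by blast
    have "f * g' - f' * g = 0"
    proof (rule poly_eq_0_cofinite[of "h * h'"])
      fix t assume "poly (h * h') t \<noteq> 0"
      then have "poly f t = \<sigma> t * poly g t" "poly f' t = \<sigma> t * poly g' t" using h h' by auto
      then show "poly (f * g' - f' * g) t = 0" by (simp add: algebra_simps)
    qed (use h h' in auto)
    then show ?thesis by simp
  qed
  have loc': "\<exists>f g. fraction f g \<and> poly g t\<^sub>0 \<noteq> 0 \<and> \<sigma> t\<^sub>0 = poly f t\<^sub>0 / poly g t\<^sub>0" for t\<^sub>0
  proof -
    obtain h f g where h: "poly h t\<^sub>0 \<noteq> 0"
        "\<And>t. poly h t \<noteq> 0 \<Longrightarrow> poly g t \<noteq> 0 \<and> \<sigma> t = poly f t / poly g t"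
      using loc[of t\<^sub>0] by blast
    then have "g \<noteq> 0" "h \<noteq> 0" by auto
    moreover have "\<sigma> t * poly g t = poly f t" if "poly h t \<noteq> 0" for t using h(2)[OF that] by simp
    ultimately have "fraction f g" unfolding fraction_def by blast
    then show ?thesis using h by blast
  qed
  \<comment> \<open>A fraction with a denominator of least degree is reduced, so that a zero of this denominator
      would be a point where no representation is regular.\<close>
  obtain f g where fg: "fraction f g" and min: "\<And>f' g'. fraction f' g' \<Longrightarrow> degree g \<le> degree g'"
  proof -
    define D where "D = (LEAST d. \<exists>f g. fraction f g \<and> degree g = d)"
    have "\<exists>d f g. fraction f g \<and> degree g = d" using loc' by blast
    then have "\<exists>f g. fraction f g \<and> degree g = D" unfolding D_def by (rule LeastI_ex)
    moreover have "D \<le> degree g'" if "fraction f' g'" for f' g'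
      unfolding D_def using that by (intro Least_le) blast
    ultimately show thesis using that by metis
  qed
  have g0: "g \<noteq> 0" using fg by (simp add: fraction_def)
  have "degree g = 0"
  proof (rule ccontr)
    assume "degree g \<noteq> 0"
    then obtain t\<^sub>1 where t1: "poly g t\<^sub>1 = 0" using alg_closed_imp_poly_has_root by blast
    obtain f1 g1 where fg1: "fraction f1 g1" "poly g1 t\<^sub>1 \<noteq> 0" using loc' by blast
    have "poly (f * g1) t\<^sub>1 = poly (f1 * g) t\<^sub>1" using cross[OF fg fg1(1)] by simp
    then have "poly f t\<^sub>1 = 0" using t1 fg1 by simp
    then obtain f' g' where f': "f = [:- t\<^sub>1, 1:] * f'" and g': "g = [:- t\<^sub>1, 1:] * g'"
      using t1 by (metis poly_eq_0_iff_dvd dvdE)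
    obtain h where h: "h \<noteq> 0" "\<And>t. poly h t \<noteq> 0 \<Longrightarrow> \<sigma> t * poly g t = poly f t"
      using fg unfolding fraction_def by blast
    have "fraction f' g'" unfolding fraction_def
    proof (intro conjI exI[of _ "[:- t\<^sub>1, 1:] * h"] allI impI)
      show "g' \<noteq> 0" using g0 g' by auto
      show "[:- t\<^sub>1, 1:] * h \<noteq> 0" using h(1) by (metis mult_eq_0_iff pCons_eq_0_iff zero_neq_one)
      fix t assume "poly ([:- t\<^sub>1, 1:] * h) t \<noteq> 0"
      then have "t - t\<^sub>1 \<noteq> 0" "poly h t \<noteq> 0" by auto
      with h(2)[of t] have "(t - t\<^sub>1) * (\<sigma> t * poly g' t) = (t - t\<^sub>1) * poly f' t"
        by (simp add: f' g' algebra_simps)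
      with \<open>t - t\<^sub>1 \<noteq> 0\<close> show "\<sigma> t * poly g' t = poly f' t" by (metis mult_left_cancel)
    qed
    moreover have "degree g = Suc (degree g')"
    proof -
      have "g' \<noteq> 0" using g0 g' by auto
      then show ?thesis unfolding g' by (subst degree_mult_eq) auto
    qed
    ultimately show False using min by fastforce
  qed
  then obtain c where c: "g = [:c:]" by (rule degree_eq_zeroE)
  have "\<sigma> t = poly (smult (1 / c) f) t" for t
  proof -
    obtain f1 g1 where fg1: "fraction f1 g1" "poly g1 t \<noteq> 0" "\<sigma> t = poly f1 t / poly g1 t"
      using loc' by blast
    have "poly (f * g1) t = poly (f1 * g) t" using cross[OF fg fg1(1)] by simp
    then have "poly g1 t * (\<sigma> t * c) = poly g1 t * poly f t"
      using fg1(2,3) c by (simp add: field_simps)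
    then have "\<sigma> t * c = poly f t" using fg1(2) by (metis mult_left_cancel)
    then show ?thesis using c g0 by (simp add: field_simps)
  qed
  then show ?thesis by blast
qed

text \<open>
  \<open>P\<close> and \<open>R\<close> describe one section of \<open>O(2)\<close> on the projective line in its two standard charts. If
  \<open>P\<close> had degree \<open>N > 2\<close>, clearing denominators in \<open>R(t) = t\<^sup>2 P(1/t)\<close> and putting \<open>t = 0\<close> would make
  its leading coefficient vanish.
\<close>

lemma quadratic_if_polynomial_at_infinity:
  fixes P R :: "'k::alg_closed_field poly"
  assumes inv: "\<And>t. t \<noteq> 0 \<Longrightarrow> poly R t = t\<^sup>2 * poly P (inverse t)"
  shows "poly P t = coeff P 0 + coeff P 1 * t + coeff P 2 * t\<^sup>2" and "poly R 0 = coeff P 2"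
proof -
  define N where "N = degree P"
  have refl: "t ^ N * poly R t = t\<^sup>2 * poly (reflect_poly P) t" if "t \<noteq> 0" for t
    using that by (simp add: inv poly_reflect_poly_nz N_def)
  have N: "N \<le> 2"
  proof (rule ccontr)
    assume "\<not> N \<le> 2"
    then obtain k where k: "N = 3 + k" using le_Suc_ex[of 3 N] by auto
    have "monom 1 (Suc k) * R - reflect_poly P = 0"
    proof (rule poly_eq_0_cofinite[of "[:0, 1:]"])
      fix t :: 'k assume "poly [:0, 1:] t \<noteq> 0"
      then have t: "t \<noteq> 0" by simp
      have "t\<^sup>2 * (t ^ Suc k * poly R t) = t\<^sup>2 * poly (reflect_poly P) t"
        using refl[OF t] by (simp add: k power_add power2_eq_square power3_eq_cube mult_ac)
      with t show "poly (monom 1 (Suc k) * R - reflect_poly P) t = 0" by (simp add: poly_monom)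
    qed simp
    then have "reflect_poly P = monom 1 (Suc k) * R" by simp
    then have "poly (reflect_poly P) 0 = 0" by (simp add: poly_monom)
    then have "lead_coeff P = 0" by (simp add: poly_0_coeff_0)
    then show False using k by (simp add: N_def)
  qed
  have "poly P t = (\<Sum>i\<le>2. coeff P i * t ^ i)"
    unfolding poly_altdef using N
    by (intro sum.mono_neutral_left) (auto simp: N_def intro: coeff_eq_0)
  then show "poly P t = coeff P 0 + coeff P 1 * t + coeff P 2 * t\<^sup>2"
    by (simp add: numeral_2_eq_2)
  have "R - monom 1 (2 - N) * reflect_poly P = 0"
  proof (rule poly_eq_0_cofinite[of "[:0, 1:]"])
    fix t :: 'k assume "poly [:0, 1:] t \<noteq> 0"
    then have t: "t \<noteq> 0" by simp
    have "t ^ N * poly R t = t ^ N * (t ^ (2 - N) * poly (reflect_poly P) t)"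
      using refl[OF t] N by (simp flip: power_add mult.assoc)
    with t show "poly (R - monom 1 (2 - N) * reflect_poly P) t = 0" by (simp add: poly_monom)
  qed simp
  then have "R = monom 1 (2 - N) * reflect_poly P" by simp
  then show "poly R 0 = coeff P 2"
    using N by (cases "N = 2") (auto simp: poly_monom N_def coeff_eq_0 power_0_left)
qed

lemma peval_polynomial_on_lines:
  "\<exists>f. \<forall>t. peval F (p + fscale t q) = poly f (t :: 'k::field)"
proof (intro exI allI)
  fix t
  have "(\<Prod>i\<in>#m. (p + fscale t q) i) = poly (\<Prod>i\<in>#m. [:p i, q i:]) t" for m
    by (induction m) (simp_all add: fscale_def algebra_simps)
  then show "peval F (p + fscale t q) = poly (\<Sum>m\<in>Poly_Mapping.keys F.
      smult (Poly_Mapping.lookup F m) (\<Prod>i\<in>#m. [:p i, q i:])) t"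
    by (simp add: peval_def poly_sum)
qed

lemma zero_not_in_cone [simp]: "0 \<notin> cone X"
  by (simp add: cone_def)

lemma global_section_0: "s \<in> global_sections I X d \<Longrightarrow> s 0 = 0"
  by (simp add: global_sections_def)

lemma global_section_local:
  assumes "s \<in> global_sections I X d" "p \<in> cone X"
  obtains a e H F G where "H \<in> forms I a" "F \<in> forms I (d + e)" "G \<in> forms I e" "peval H p \<noteq> 0"
    "\<And>q. q \<in> cone X \<Longrightarrow> peval H q \<noteq> 0 \<Longrightarrow> peval G q \<noteq> 0 \<and> s q = peval F q / peval G q"
  using assms(1)[unfolded global_sections_def, THEN CollectD, THEN conjunct2, THEN bspec, OF assms(2)]
  by (elim exE conjE) (rule that, assumption+, simp)

lemma global_section_fscale:
  assumes s: "s \<in> global_sections I X d" and d: "d > 0"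
    and c: "\<And>x. fscale x p \<in> cone X \<union> {0}"
  shows "s (fscale x p) = x ^ d * s p"
proof (cases "x = 0 \<or> p = 0")
  case True
  then show ?thesis using global_section_0[OF s] d by (auto simp: power_0_left)
next
  case False
  then have "fscale x p \<noteq> 0" by (auto simp: fscale_def fun_eq_iff)
  with False c[of x] c[of 1] have cone: "p \<in> cone X" "fscale x p \<in> cone X" by auto
  obtain a e H F G where H: "H \<in> forms I a" and F: "F \<in> forms I (d + e)" and G: "G \<in> forms I e"
    and p: "peval H p \<noteq> 0"
    and q: "\<And>q. q \<in> cone X \<Longrightarrow> peval H q \<noteq> 0 \<Longrightarrow> peval G q \<noteq> 0 \<and> s q = peval F q / peval G q"
    using global_section_local[OF s cone(1)] by metis
  have "peval H (fscale x p) \<noteq> 0" using p False by (simp add: peval_fscale[OF H])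
  then have "s (fscale x p) = x ^ (d + e) * peval F p / (x ^ e * peval G p)"
    using q[OF cone(2)] by (simp add: peval_fscale[OF F] peval_fscale[OF G])
  also have "\<dots> = x ^ d * (peval F p / peval G p)" using False by (simp add: power_add)
  also have "\<dots> = x ^ d * s p" using q[OF cone(1) p] by simp
  finally show ?thesis .
qed

lemma global_section_polynomial_on_affine_line:
  fixes s :: "('i \<Rightarrow> 'k::alg_closed_field) \<Rightarrow> 'k"
  assumes s: "s \<in> global_sections I X d" and cone: "\<And>t. p + fscale t q \<in> cone X"
  shows "\<exists>P. \<forall>t. s (p + fscale t q) = poly P t"
proof (rule locally_fraction_imp_polynomial)
  fix t\<^sub>0
  obtain a e H F G where H: "H \<in> forms I a" and F: "F \<in> forms I (d + e)" and G: "G \<in> forms I e"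
    and p: "peval H (p + fscale t\<^sub>0 q) \<noteq> 0"
    and q: "\<And>q. q \<in> cone X \<Longrightarrow> peval H q \<noteq> 0 \<Longrightarrow> peval G q \<noteq> 0 \<and> s q = peval F q / peval G q"
    using global_section_local[OF s cone[of t\<^sub>0]] by metis
  obtain h where h: "\<And>t. peval H (p + fscale t q) = poly h t"
    using peval_polynomial_on_lines by metis
  obtain f where f: "\<And>t. peval F (p + fscale t q) = poly f t"
    using peval_polynomial_on_lines by metis
  obtain g where g: "\<And>t. peval G (p + fscale t q) = poly g t"
    using peval_polynomial_on_lines by metis
  have "poly h t\<^sub>0 \<noteq> 0" using p unfolding h .
  moreover have "poly g t \<noteq> 0 \<and> s (p + fscale t q) = poly f t / poly g t" if "poly h t \<noteq> 0" for t
    using q[OF cone[of t]] that unfolding h f g by simp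
  ultimately show "\<exists>h f g. poly h t\<^sub>0 \<noteq> 0 \<and> (\<forall>t. poly h t \<noteq> 0 \<longrightarrow>
      poly g t \<noteq> 0 \<and> s (p + fscale t q) = poly f t / poly g t)" by (metis (no_types, lifting))
qed

text \<open>
  If \<open>p\<close> and \<open>q\<close> are independent, they span a line contained in \<open>X\<close>, and the section restricts to a
  section of \<open>O(2)\<close> there. If they are dependent, the claim is homogeneity on the multiples of one
  vector \<open>r\<close>.
\<close>

lemma global_section_quadratic_on_line:
  fixes s :: "('i \<Rightarrow> 'k::alg_closed_field) \<Rightarrow> 'k"
  assumes s: "s \<in> global_sections I X 2"
    and plane: "\<And>x y. fscale x p + fscale y q \<in> cone X \<union> {0}"
  shows "\<exists>a b c. \<forall>x y. s (fscale x p + fscale y q) = a * x\<^sup>2 + b * x * y + c * y\<^sup>2"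
proof -
  have sc: "s (fscale z (fscale x p + fscale y q)) = z\<^sup>2 * s (fscale x p + fscale y q)" for x y z
    using plane[of "_ * x" "_ * y"]
    by (intro global_section_fscale[OF s]) (simp_all add: fscale_add)
  show ?thesis
  proof (cases "\<exists>x y. (x \<noteq> 0 \<or> y \<noteq> 0) \<and> fscale x p + fscale y q = 0")
    case True
    then obtain x y where xy: "x \<noteq> 0 \<or> y \<noteq> 0" and 0: "fscale x p + fscale y q = 0" by blast
    have "\<exists>a b u v. p = fscale a (fscale u p + fscale v q) \<and> q = fscale b (fscale u p + fscale v q)"
    proof (cases "x = 0")
      case True
      then have "q = fscale 0 p" using xy 0 by (auto simp: fscale_def fun_eq_iff)
      then show ?thesis by (intro exI[of _ 1] exI[of _ 0]) simp
    next
      case False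
      have "p = fscale (- y / x) q"
      proof
        fix i have "x * p i + y * q i = 0" using 0 by (simp add: fscale_def fun_eq_iff)
        then show "p i = fscale (- y / x) q i" using False by (simp add: fscale_def field_simps eq_neg_iff_add_eq_0)
      qed
      then show ?thesis by (intro exI[of _ "- y / x"] exI[of _ 1] exI[of _ 0]) simp
    qed
    then obtain r a b u v where r: "r = fscale u p + fscale v q"
        and p: "p = fscale a r" and q: "q = fscale b r" by metis
    have "fscale x p + fscale y q = fscale (x * a + y * b) r" for x y
    proof -
      have "fscale x p + fscale y q = fscale x (fscale a r) + fscale y (fscale b r)"
        using p q by metis
      also have "\<dots> = fscale (x * a + y * b) r"
        by (simp add: fscale_def fun_eq_iff algebra_simps)
      finally show ?thesis .
    qed
    then have "s (fscale x p + fscale y q) = (x * a + y * b)\<^sup>2 * s r" for x y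
      using sc[of "x * a + y * b" u v] unfolding r[symmetric] by metis
    then have "s (fscale x p + fscale y q)
        = (a\<^sup>2 * s r) * x\<^sup>2 + (2 * a * b * s r) * x * y + (b\<^sup>2 * s r) * y\<^sup>2" for x y
      by (simp add: power2_eq_square algebra_simps)
    then show ?thesis by blast
  next
    case False
    have "p + fscale t q \<in> cone X" for t using plane[of 1 t] False by (metis UnE fscale_1 singletonD zero_neq_one)
    then obtain P where P: "\<And>t. s (p + fscale t q) = poly P t"
      using global_section_polynomial_on_affine_line[OF s] by metis
    have "q + fscale t p \<in> cone X" for t
      using plane[of t 1] False by (metis UnE add.commute fscale_1 singletonD zero_neq_one)
    then obtain R where R: "\<And>t. s (q + fscale t p) = poly R t"
      using global_section_polynomial_on_affine_line[OF s] by metis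
    have "poly R t = t\<^sup>2 * poly P (inverse t)" if "t \<noteq> 0" for t
      using sc[of t 1 "inverse t"] that by (simp add: P[symmetric] R[symmetric] fscale_add add.commute)
    note PR = quadratic_if_polynomial_at_infinity[OF this]
    have "s (fscale x p + fscale y q) = coeff P 0 * x\<^sup>2 + coeff P 1 * x * y + coeff P 2 * y\<^sup>2" for x y
    proof (cases "x = 0")
      case True
      then show ?thesis using sc[of y 0 1] R[of 0] PR(2) by simp
    next
      case False
      have "fscale x p + fscale y q = fscale x (fscale 1 p + fscale (y / x) q)"
        using False by (simp add: fscale_add)
      then have "s (fscale x p + fscale y q) = x\<^sup>2 * poly P (y / x)"
        using sc[of x 1 "y / x"] P by simp
      also have "\<dots> = coeff P 0 * x\<^sup>2 + coeff P 1 * (x\<^sup>2 * (y / x)) + coeff P 2 * (x\<^sup>2 * (y / x)\<^sup>2)"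
        by (simp add: PR(1) algebra_simps)
      also have "\<dots> = coeff P 0 * x\<^sup>2 + coeff P 1 * (x * y) + coeff P 2 * y\<^sup>2"
        using False by (simp add: power2_eq_square)
      finally show ?thesis by (simp add: mult.assoc)
    qed
    then show ?thesis by blast
  qed
qed

section \<open>Quadrics containing the Veronese variety\<close>

definition unit_vec :: "'i \<Rightarrow> 'i \<Rightarrow> 'k::zero_neq_one" where
  "unit_vec i = (\<lambda>j. if j = i then 1 else 0)"

definition dot :: "nat \<Rightarrow> (nat \<Rightarrow> 'k::comm_ring_1) \<Rightarrow> (nat \<Rightarrow> 'k) \<Rightarrow> 'k" where
  "dot n a v = (\<Sum>i\<le>n. a i * v i)"

lemma dot_unit_vec [simp]: "i \<le> n \<Longrightarrow> dot n a (unit_vec i) = a i"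
  by (simp add: dot_def unit_vec_def if_distrib sum.delta cong: if_cong)

lemma quadratic_cmult: "quadratic q \<Longrightarrow> quadratic (\<lambda>v. c * q v)"
proof -
  have "polar (\<lambda>v. c * q v) v w = c * polar q v w" for v w
    by (simp add: polar_def algebra_simps)
  then show "quadratic q \<Longrightarrow> quadratic (\<lambda>v. c * q v)"
    by (simp add: quadratic_def algebra_simps)
qed

lemma quadratic_add_fun: "quadratic q \<Longrightarrow> quadratic r \<Longrightarrow> quadratic (\<lambda>v. q v + r v)"
proof -
  have "polar (\<lambda>v. q v + r v) v w = polar q v w + polar r v w" for v w
    by (simp add: polar_def)
  then show "quadratic q \<Longrightarrow> quadratic r \<Longrightarrow> quadratic (\<lambda>v. q v + r v)"
    by (simp add: quadratic_def algebra_simps)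
qed

lemma quadratic_sum: "(\<And>a. a \<in> A \<Longrightarrow> quadratic (q a)) \<Longrightarrow> quadratic (\<lambda>v. \<Sum>a\<in>A. q a v)"
proof (induction A rule: infinite_finite_induct)
  case (insert a A)
  then show ?case by (simp add: quadratic_add_fun)
qed (auto simp: quadratic_def polar_def)

lemma polar_coordinate_product: "polar (\<lambda>y. y i * y j) y z = y i * z j + z i * (y j :: 'k::field)"
  by (simp add: polar_def algebra_simps)

lemma quadratic_coordinate_product: "quadratic (\<lambda>y. y i * (y j :: 'k::field))"
  by (simp add: quadratic_def polar_coordinate_product fscale_def algebra_simps power2_eq_square)

lemma quadratic_monomial:
  assumes "M \<in> multisets_of_size I 2" shows "quadratic (\<lambda>y. \<Prod>i\<in>#M. (y i :: 'k::field))"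
proof -
  obtain i j where "M = {#i, j#}" using assms by (auto simp: mem_multisets_of_size_2)
  then show ?thesis using quadratic_coordinate_product[of i j] by simp
qed

lemma quadratic_peval:
  assumes "Q \<in> forms I 2" shows "quadratic (peval (Q :: ('i, 'k::field) mpol))"
proof -
  have "quadratic (\<lambda>v. \<Sum>M\<in>Poly_Mapping.keys Q. Poly_Mapping.lookup Q M * (\<Prod>i\<in>#M. v i))"
    using assms by (intro quadratic_sum quadratic_cmult quadratic_monomial[of _ I]) (auto simp: forms_def)
  then show ?thesis by (simp add: peval_def[abs_def])
qed

text \<open>
  Polar forms determine the coefficients of a quadric, provided that \<open>2\<close> is invertible.
\<close>

lemma polar_peval_unit_vec:
  assumes "Q \<in> forms I 2"
  shows "polar (peval Q) (unit_vec m) (unit_vec m') =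
    Poly_Mapping.lookup Q {#m, m'#} * (if m = m' then 2 else 1 :: 'k::field)"
proof -
  let ?c = "if m = m' then 2 else 1 :: 'k"
  have mono: "polar (\<lambda>y. \<Prod>i\<in>#M. y i) (unit_vec m) (unit_vec m') = (if M = {#m, m'#} then ?c else 0)"
    if "M \<in> Poly_Mapping.keys Q" for M
  proof -
    have "M \<in> multisets_of_size I 2" using that assms by (auto simp: forms_def)
    then obtain i j where M: "M = {#i, j#}" by (auto simp: mem_multisets_of_size_2)
    show ?thesis
      using polar_coordinate_product[of i j "unit_vec m" "unit_vec m'"]
      by (auto simp: M unit_vec_def add_eq_conv_ex)
  qed
  have expand: "polar (peval Q) y z = (\<Sum>M\<in>Poly_Mapping.keys Q. Poly_Mapping.lookup Q M *
      polar (\<lambda>y. \<Prod>i\<in>#M. y i) y z)" for y z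
    by (simp add: polar_def peval_def sum_subtractf right_diff_distrib plus_fun_def)
  have "polar (peval Q) (unit_vec m) (unit_vec m') =
      (\<Sum>M\<in>Poly_Mapping.keys Q. if M = {#m, m'#} then Poly_Mapping.lookup Q M * ?c else 0)"
    unfolding expand by (intro sum.cong refl) (simp add: mono)
  also have "\<dots> = Poly_Mapping.lookup Q {#m, m'#} * ?c"
    by (simp add: sum.delta in_keys_iff)
  finally show ?thesis .
qed

text \<open>
  Twice the product \<open>ab\<close> in the symmetric square, in the coordinates for which the Veronese map is
  \<open>v \<mapsto> vv\<close>. Leaving the factor \<open>2\<close> in place avoids denominators.
\<close>

definition sym_prod :: "nat \<Rightarrow> (nat \<Rightarrow> 'k::field) \<Rightarrow> (nat \<Rightarrow> 'k) \<Rightarrow> nat multiset \<Rightarrow> 'k" where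
  "sym_prod n a b = veronese_vec {..n} 2 (a + b) - veronese_vec {..n} 2 a - veronese_vec {..n} 2 b"

lemma veronese_vec_pair:
  "i \<in> I \<Longrightarrow> j \<in> I \<Longrightarrow> veronese_vec I 2 v {#i, j#} = v i * v j"
  by (auto simp: veronese_vec_def mem_multisets_of_size_2)

lemma veronese_vec_outside: "m \<notin> multisets_of_size I 2 \<Longrightarrow> veronese_vec I 2 v m = 0"
  by (simp add: veronese_vec_def)

lemma sym_prod_pair:
  "i \<le> n \<Longrightarrow> j \<le> n \<Longrightarrow> sym_prod n a b {#i, j#} = a i * b j + a j * b i"
  by (simp add: sym_prod_def veronese_vec_pair algebra_simps)

lemma sym_prod_outside: "m \<notin> multisets_of_size {..n} 2 \<Longrightarrow> sym_prod n a b m = 0"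
  by (simp add: sym_prod_def veronese_vec_outside)

lemma veronese_coordinates_eqI:
  assumes "\<And>i j. i \<in> I \<Longrightarrow> j \<in> I \<Longrightarrow> f {#i, j#} = g {#i, j#}"
    and "\<And>m. m \<notin> multisets_of_size I 2 \<Longrightarrow> f m = g m"
  shows "f = g"
  using assms by (metis ext mem_multisets_of_size_2)

lemma sym_prod_commute: "sym_prod n a b = sym_prod n b a"
  by (rule veronese_coordinates_eqI[of "{..n}"]) (auto simp: sym_prod_pair sym_prod_outside)

lemma sym_prod_add: "sym_prod n (a + a') b = sym_prod n a b + sym_prod n a' b"
  by (rule veronese_coordinates_eqI[of "{..n}"])
    (auto simp: sym_prod_pair sym_prod_outside algebra_simps)

lemma sym_prod_scale: "sym_prod n (fscale c a) b = fscale c (sym_prod n a b)"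
  by (rule veronese_coordinates_eqI[of "{..n}"])
    (auto simp: sym_prod_pair sym_prod_outside fscale_def algebra_simps)

lemma sym_prod_self: "sym_prod n v v = fscale 2 (veronese_vec {..n} 2 v)"
  by (rule veronese_coordinates_eqI[of "{..n}"])
    (auto simp: sym_prod_pair sym_prod_outside veronese_vec_pair veronese_vec_outside fscale_def)

lemma sym_prod_unit_vec:
  assumes "i \<le> n" "j \<le> n"
  shows "sym_prod n (unit_vec i) (unit_vec j) = fscale (if i = j then 2 else 1) (unit_vec {#i, j#})"
  by (rule veronese_coordinates_eqI[of "{..n}"])
    (use assms in \<open>auto simp: sym_prod_pair sym_prod_outside fscale_def unit_vec_def add_eq_conv_ex
      mem_multisets_of_size_2\<close>)

text \<open>
  A quadric on the symmetric square as a four-linear form on the vector space itself.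
\<close>

definition curvature :: "nat \<Rightarrow> (nat multiset, 'k::field) mpol \<Rightarrow>
    (nat \<Rightarrow> 'k) \<Rightarrow> (nat \<Rightarrow> 'k) \<Rightarrow> (nat \<Rightarrow> 'k) \<Rightarrow> (nat \<Rightarrow> 'k) \<Rightarrow> 'k" where
  "curvature n Q a b c d = polar (peval Q) (sym_prod n a b) (sym_prod n c d)"

lemma curvature_sym: "curvature n Q b a c d = curvature n Q a b c d"
  by (simp add: curvature_def sym_prod_commute[of n b])

lemma curvature_pair: "curvature n Q c d a b = curvature n Q a b c d"
  by (simp add: curvature_def polar_commute)

lemma curvature_add: "curvature n (Q + Q') a b c d = curvature n Q a b c d + curvature n Q' a b c d"
  by (simp add: curvature_def polar_def peval_add)

lemma curvature_diff: "curvature n (Q - Q') a b c d = curvature n Q a b c d - curvature n Q' a b c d"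
  by (simp add: curvature_def polar_def peval_diff)

lemma curvature_pscale: "curvature n (pscale x Q) a b c d = x * curvature n Q a b c d"
  by (simp add: curvature_def polar_def peval_pscale algebra_simps)

lemma curvature_sum: "curvature n (sum f A) a b c d = (\<Sum>i\<in>A. curvature n (f i) a b c d)"
  by (simp add: curvature_def polar_def peval_sum sum_subtractf)

lemma cone_span: "cone {fvec.span {g v} |v. v \<in> S} = {fscale c (g v) |c v. v \<in> S} - {0}"
  by (auto simp: cone_def fvec.span_singleton)

lemma dim_span_singleton: "v \<noteq> 0 \<Longrightarrow> fvec.dim (fvec.span {v}) = 1"
  using fvec.dim_eq_card_independent[of "{v}"] by (simp add: fvec.dim_span)

lemma subspace_coord_space: "fvec.subspace (coord_space I)"
  by (auto simp: fvec.subspace_def coord_space_def fscale_def)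

lemma cone_proj_space: "cone (proj_space (coord_space I)) = coord_space I - {0 :: 'i \<Rightarrow> 'k::field}"
proof (intro equalityI subsetI)
  fix v :: "'i \<Rightarrow> 'k" assume v: "v \<in> coord_space I - {0}"
  then have "fvec.span {v} \<in> proj_space (coord_space I)"
    using fvec.span_minimal[of "{v}", OF _ subspace_coord_space]
    by (auto simp: proj_space_def dim_span_singleton simp del: fvec.dim_span)
  then show "v \<in> cone (proj_space (coord_space I))"
    using v by (auto simp: cone_def intro: fvec.span_base)
qed (auto simp: cone_def proj_space_def)

lemma veronese_vec_fscale: "veronese_vec I 2 (fscale c v) = fscale (c\<^sup>2) (veronese_vec I 2 v)"
  by (rule veronese_coordinates_eqI[of I])
    (auto simp: veronese_vec_pair veronese_vec_outside fscale_def power2_eq_square mult_ac)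

lemma veronese_vec_cong: "(\<And>i. i \<in> I \<Longrightarrow> v i = w i) \<Longrightarrow> veronese_vec I 2 v = veronese_vec I 2 w"
  by (rule veronese_coordinates_eqI[of I]) (auto simp: veronese_vec_pair veronese_vec_outside)

text \<open>
  Neither \<open>v \<noteq> 0\<close> nor a bound on the support of \<open>v\<close> remains on the right, so that the condition can be
  polarised freely.
\<close>

lemma mem_veronese_ideal_2:
  "Q \<in> veronese_ideal_2 n \<longleftrightarrow>
    Q \<in> forms (multisets_of_size {..n} 2) 2 \<and> (\<forall>v. peval Q (veronese_vec {..n} 2 v) = 0)"
  (is "?L \<longleftrightarrow> ?R")
proof
  assume L: ?L
  have "peval Q (veronese_vec {..n} 2 v) = 0" for v
  proof (cases "veronese_vec {..n} 2 v = 0")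
    case True
    have "quadratic (peval Q)" using L quadratic_peval by (auto simp: veronese_ideal_2_def Let_def)
    from quadratic_scale[OF this, of 0 0] show ?thesis unfolding True by simp
  next
    case False
    define w where "w = (\<lambda>i. if i \<le> n then v i else 0)"
    have vw: "veronese_vec {..n} 2 v = veronese_vec {..n} 2 w"
      by (rule veronese_vec_cong) (simp add: w_def)
    have "w \<noteq> 0"
    proof
      assume "w = 0"
      then have "veronese_vec {..n} 2 w = 0"
        by (intro veronese_coordinates_eqI[of "{..n}"]) (auto simp: veronese_vec_pair veronese_vec_outside)
      with False vw show False by simp
    qed
    moreover have "w \<in> coord_space {..n}" by (simp add: w_def coord_space_def)
    ultimately have "w \<in> cone (proj_space (coord_space {..n}))" by (simp add: cone_proj_space)
    then have "veronese_vec {..n} 2 w \<in> cone (veronese_variety n)"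
      unfolding veronese_variety_def veronese_def cone_span using False vw
      by simp (metis fscale_1)
    then show ?thesis using L vw
      by (simp add: veronese_ideal_2_def Let_def homogeneous_ideal_def)
  qed
  then show ?R using L by (simp add: veronese_ideal_2_def Let_def)
next
  assume R: ?R
  have "peval Q y = 0" if y: "y \<in> cone (veronese_variety n)" for y
  proof -
    obtain c v where "y = fscale c (veronese_vec {..n} 2 v)"
      using y unfolding veronese_variety_def veronese_def cone_span by auto
    then show ?thesis using R peval_fscale[of Q "multisets_of_size {..n} 2" 2] by simp
  qed
  then show ?L using R by (auto simp: veronese_ideal_2_def Let_def homogeneous_ideal_def poly_ring_def
        forms_def multisets_of_size_def)
qed

lemma curvature_form_veronese_ideal:
  assumes "(2::'k::field) \<noteq> 0" "Q \<in> veronese_ideal_2 n"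
  shows "curvature_form (curvature n (Q :: (nat multiset, 'k) mpol))"
proof
  note Q = assms(2)[unfolded mem_veronese_ideal_2]
  have q: "quadratic (peval Q)" using Q quadratic_peval by blast
  show "(2::'k) \<noteq> 0" by fact
  fix a a' b c d :: "nat \<Rightarrow> 'k" and x :: 'k
  show "curvature n Q (a + a') b c d = curvature n Q a b c d + curvature n Q a' b c d"
    using q by (simp add: curvature_def sym_prod_add quadratic_def)
  show "curvature n Q (fscale x a) b c d = x * curvature n Q a b c d"
    using q by (simp add: curvature_def sym_prod_scale quadratic_def)
  have "polar (peval Q) y y = 2 * peval Q y" for y
  proof -
    have "y + y = fscale 2 y" by (simp add: fscale_def fun_eq_iff)
    then show ?thesis using quadratic_scale[OF q, of 2 y] by (simp add: polar_def)
  qed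
  then show "curvature n Q a a a a = 0"
    using Q quadratic_scale[OF q] by (simp add: curvature_def sym_prod_self)
qed (simp_all add: curvature_sym curvature_pair)

text \<open>
  Products of unit vectors are nonzero multiples of the coordinate vectors of the symmetric square, so
  that the curvature tensor determines all coefficients.
\<close>

lemma form_eq_0_if_curvature_eq_0:
  assumes two: "(2::'k::field) \<noteq> 0" and Q: "Q \<in> forms (multisets_of_size {..n} 2) 2"
    and 0: "\<And>i j k l. i \<le> n \<Longrightarrow> j \<le> n \<Longrightarrow> k \<le> n \<Longrightarrow> l \<le> n \<Longrightarrow>
      curvature n Q (unit_vec i) (unit_vec j) (unit_vec k) (unit_vec l) = (0::'k)"
  shows "Q = 0"
proof (rule poly_mapping_eqI)
  fix M
  have q: "quadratic (peval Q)" using Q quadratic_peval by blast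
  have "Poly_Mapping.lookup Q M = 0" if M: "M \<in> multisets_of_size (multisets_of_size {..n} 2) 2"
  proof -
    obtain i j k l where le: "i \<le> n" "j \<le> n" "k \<le> n" "l \<le> n" and M: "M = {#{#i, j#}, {#k, l#}#}"
      using M by (auto simp: mem_multisets_of_size_2)
    have "polar (peval Q) (fscale x y) (fscale x' y') = x * x' * polar (peval Q) y y'" for x x' y y'
      using q polar_commute[of "peval Q"] by (metis quadratic_def mult.assoc)
    with 0[OF le] two have "polar (peval Q) (unit_vec {#i, j#}) (unit_vec {#k, l#}) = 0"
      by (simp add: curvature_def sym_prod_unit_vec le split: if_splits)
    then show ?thesis using two unfolding polar_peval_unit_vec[OF Q] M by (simp split: if_splits)
  qed
  then show "Poly_Mapping.lookup Q M = Poly_Mapping.lookup 0 M"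
    using Q by (auto simp: forms_def in_keys_iff)
qed

section \<open>The quadric of a pair of linear forms\<close>

text \<open>
  The product of the linear forms with coefficients \<open>a\<close> and \<open>b\<close>, as a linear form on the symmetric
  square.
\<close>

definition bracket :: "nat \<Rightarrow> (nat \<Rightarrow> 'k::field) \<Rightarrow> (nat \<Rightarrow> 'k) \<Rightarrow> (nat multiset, 'k) mpol" where
  "bracket n a b = (\<Sum>i\<le>n. \<Sum>j\<le>n. Poly_Mapping.single {#{#i, j#}#} (a i * b j))"

lemma bracket_in_forms: "bracket n a b \<in> forms (multisets_of_size {..n} 2) 1"
  unfolding bracket_def
  by (intro forms_sum forms_single) (auto simp: multisets_of_size_def)

lemma bracket_commute: "bracket n a b = bracket n b a"
  unfolding bracket_def by (subst sum.swap) (simp add: add_mset_commute mult.commute)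

lemma bracket_add_left: "bracket n (a + a') b = bracket n a b + bracket n a' b"
  by (simp add: bracket_def distrib_right single_add sum.distrib)

lemma bracket_add_right: "bracket n a (b + b') = bracket n a b + bracket n a b'"
  by (metis bracket_add_left bracket_commute)

lemma peval_bracket: "peval (bracket n a b) y = (\<Sum>i\<le>n. \<Sum>j\<le>n. a i * b j * y {#i, j#})"
  by (simp add: bracket_def peval_sum peval_single)

lemma peval_bracket_veronese:
  "peval (bracket n a b) (veronese_vec {..n} 2 v) = dot n a v * dot n b v"
  by (simp add: peval_bracket veronese_vec_pair dot_def sum_product mult_ac)

lemma peval_bracket_sym_prod:
  "peval (bracket n a b) (sym_prod n c d) = dot n a c * dot n b d + dot n a d * dot n b c"
  by (simp add: peval_bracket sym_prod_pair dot_def sum_product distrib_left sum.distrib mult_ac)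

lemma peval_linear_form_add:
  assumes "p \<in> forms I 1"
  shows "peval p (y + z) = peval p y + peval p (z :: _ \<Rightarrow> 'k::comm_ring_1)"
proof -
  have "(\<Prod>i\<in>#m. (y + z) i) = (\<Prod>i\<in>#m. y i) + (\<Prod>i\<in>#m. z i)" if "m \<in> Poly_Mapping.keys p" for m
    using that assms unfolding forms_def mem_multisets_of_size_1[of m I, symmetric]
    by (auto simp: mem_multisets_of_size_1[unfolded One_nat_def] subset_eq)
  then show ?thesis by (simp add: peval_def distrib_left sum.distrib cong: sum.cong)
qed

lemma polar_mult_linear_forms:
  assumes "p \<in> forms I 1" "q \<in> forms I 1"
  shows "polar (peval (p * q)) y z = peval p y * peval q z + peval p z * peval q y"
  using peval_linear_form_add[OF assms(1)] peval_linear_form_add[OF assms(2)]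
  by (simp add: polar_def peval_mult algebra_simps)

text \<open>
  It contains the Veronese variety because it restricts there to \<open>a\<^sup>2 b\<^sup>2 - (ab)\<^sup>2 = 0\<close>, and its curvature
  will turn out to be the square of the bivector \<open>a \<and> b\<close> in disguise.
\<close>

definition pencil_quadric :: "nat \<Rightarrow> (nat \<Rightarrow> 'k::field) \<Rightarrow> (nat \<Rightarrow> 'k) \<Rightarrow> (nat multiset, 'k) mpol" where
  "pencil_quadric n a b = bracket n a a * bracket n b b - (bracket n a b)\<^sup>2"

lemma mult_brackets_in_forms:
  "bracket n a b * bracket n c d \<in> forms (multisets_of_size {..n} 2) 2"
  using forms_mult[OF bracket_in_forms bracket_in_forms] by (simp add: numeral_2_eq_2)

lemma pencil_quadric_in_ideal: "pencil_quadric n a b \<in> veronese_ideal_2 n"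
  unfolding mem_veronese_ideal_2
  by (auto simp: pencil_quadric_def power2_eq_square peval_diff peval_mult peval_bracket_veronese
      intro!: forms_diff mult_brackets_in_forms)

lemma curvature_mult_brackets:
  "curvature n (bracket n a b * bracket n c d) e f g h =
    (dot n a e * dot n b f + dot n a f * dot n b e) * (dot n c g * dot n d h + dot n c h * dot n d g)
    + (dot n a g * dot n b h + dot n a h * dot n b g) * (dot n c e * dot n d f + dot n c f * dot n d e)"
  unfolding curvature_def polar_mult_linear_forms[OF bracket_in_forms bracket_in_forms]
  by (simp add: peval_bracket_sym_prod)

text \<open>
  Exchanging the second and the fourth argument separates the square of the bivector from the curvature
  tensor. The factor \<open>6\<close> has to be invertible for the square to be recovered.
\<close>

lemma curvature_pencil_quadric:
  "curvature n (pencil_quadric n a b) e f g h - curvature n (pencil_quadric n a b) e h g f =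
    6 * (dot n a e * dot n b g - dot n a g * dot n b e) * (dot n a f * dot n b h - dot n a h * dot n b f)"
  unfolding pencil_quadric_def power2_eq_square curvature_diff curvature_mult_brackets
  by (simp add: algebra_simps)

section \<open>From quadrics to symmetric squares of bivectors\<close>

text \<open>
  The linear map behind both projective equivalences. Its value at the monomial \<open>p\<^sub>i\<^sub>k p\<^sub>j\<^sub>l\<close> in the
  Pluecker coordinates is a component of the Riemann tensor, in the pairs \<open>(i, k)\<close> and \<open>(j, l)\<close>. This
  tensor is symmetric in the two pairs, so that either order of the two factors may be chosen. The
  factor \<open>1/6\<close> makes the pencil quadric of \<open>a\<close> and \<open>b\<close> correspond to the square of \<open>a \<and> b\<close> itself.
\<close>

definition bivector_of :: "nat \<Rightarrow> (nat multiset, 'k::field) mpol \<Rightarrow> (nat \<times> nat) multiset \<Rightarrow> 'k" where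
  "bivector_of n Q = (\<lambda>m. if m \<in> multisets_of_size (pluecker_index n) 2 then
     (let ((i, k), (j, l)) = (SOME (\<alpha>, \<beta>). m = {#\<alpha>, \<beta>#})
      in (curvature n Q (unit_vec i) (unit_vec j) (unit_vec k) (unit_vec l)
        - curvature n Q (unit_vec i) (unit_vec l) (unit_vec k) (unit_vec j)) / 6) else 0)"

lemma bivector_of_pair:
  assumes "(i, k) \<in> pluecker_index n" "(j, l) \<in> pluecker_index n"
  shows "bivector_of n Q {#(i, k), (j, l)#} =
    (curvature n Q (unit_vec i) (unit_vec j) (unit_vec k) (unit_vec l)
      - curvature n Q (unit_vec i) (unit_vec l) (unit_vec k) (unit_vec j)) / 6"
proof -
  let ?m = "{#(i, k), (j, l)#}"
  have m: "?m \<in> multisets_of_size (pluecker_index n) 2"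
    using assms by (auto simp: mem_multisets_of_size_2)
  define p where "p = (SOME (\<alpha>, \<beta>). ?m = {#\<alpha>, \<beta>#})"
  have "(\<lambda>(\<alpha>, \<beta>). ?m = {#\<alpha>, \<beta>#}) p" unfolding p_def by (rule someI[of _ "((i, k), (j, l))"]) simp
  then have "p = ((i, k), (j, l)) \<or> p = ((j, l), (i, k))"
    by (cases p) (auto simp: add_eq_conv_ex)
  moreover have "curvature n Q a b c d - curvature n Q a d c b
      = curvature n Q b a d c - curvature n Q b c d a" for a b c d
    using curvature_sym[of n Q] curvature_pair[of n Q] by metis
  ultimately show ?thesis
    unfolding bivector_of_def p_def[symmetric] using m by (elim disjE) (simp_all add: Let_def)
qed

lemma bivector_of_outside: "m \<notin> multisets_of_size (pluecker_index n) 2 \<Longrightarrow> bivector_of n Q m = 0"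
  by (simp add: bivector_of_def)

lemma linear_bivector_of: "Vector_Spaces.linear pscale fscale (bivector_of n)"
proof (unfold_locales, goal_cases)
  case (1 Q Q')
  show ?case
    by (rule veronese_coordinates_eqI[of "pluecker_index n"])
      (auto simp: bivector_of_pair bivector_of_outside curvature_add simp flip: add_divide_distrib)
next
  case (2 c Q)
  show ?case
    by (rule veronese_coordinates_eqI[of "pluecker_index n"])
      (auto simp: bivector_of_pair bivector_of_outside curvature_pscale fscale_def right_diff_distrib)
qed

lemma bivector_of_pencil_quadric:
  assumes "(2::'k) \<noteq> 0" "(3::'k) \<noteq> 0"
  shows "bivector_of n (pencil_quadric n a b) =
    veronese_vec (pluecker_index n) 2 (wedge a (b :: nat \<Rightarrow> 'k::field))"
proof (rule veronese_coordinates_eqI[of "pluecker_index n"])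
  have "(6::'k) = 2 * 3" by simp
  then have 6: "(6::'k) \<noteq> 0" using assms by (metis mult_eq_0_iff)
  fix \<alpha> \<beta> assume "\<alpha> \<in> pluecker_index n" "\<beta> \<in> pluecker_index n"
  then show "bivector_of n (pencil_quadric n a b) {#\<alpha>, \<beta>#} =
      veronese_vec (pluecker_index n) 2 (wedge a b) {#\<alpha>, \<beta>#}"
    using 6 by (cases \<alpha>; cases \<beta>)
      (simp add: bivector_of_pair veronese_vec_pair curvature_pencil_quadric pluecker_index_def wedge_def)
qed (simp add: bivector_of_outside veronese_vec_outside)

text \<open>
  If the Riemann tensor vanishes, the curvature tensor is totally symmetric, and the Bianchi identity
  says that three times it is zero.
\<close>

lemma bivector_of_eq_0:
  assumes two: "(2::'k::field) \<noteq> 0" and three: "(3::'k) \<noteq> 0"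
    and Q: "Q \<in> veronese_ideal_2 n" and 0: "bivector_of n Q = (0 :: _ \<Rightarrow> 'k)"
  shows "Q = 0"
proof (rule form_eq_0_if_curvature_eq_0[OF two])
  show "Q \<in> forms (multisets_of_size {..n} 2) 2" using Q by (simp add: mem_veronese_ideal_2)
  let ?T = "\<lambda>i j k l. curvature n Q (unit_vec i) (unit_vec j) (unit_vec k) (unit_vec l)"
  interpret curvature_form "curvature n Q" by (rule curvature_form_veronese_ideal[OF two Q])
  have "(6::'k) = 2 * 3" by simp
  then have 6: "(6::'k) \<noteq> 0" using two three by (metis mult_eq_0_iff)
  have ordered: "?T i j k l = ?T i l k j" if "i < k" "k \<le> n" "j < l" "l \<le> n" for i j k l
    using fun_cong[OF 0, of "{#(i, k), (j, l)#}"] that 6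
    by (simp add: bivector_of_pair pluecker_index_def)
  \<comment> \<open>The Pluecker coordinates cover increasing pairs only; the other orders follow by symmetry.\<close>
  have exchange: "?T i j k l = ?T i l k j" if "i \<le> n" "j \<le> n" "k \<le> n" "l \<le> n" for i j k l
  proof -
    have 1: "?T i j k l = ?T k l i j" and 2: "?T k j i l = ?T i l k j" by (rule pair)+
    consider "i = k" | "j = l" | "i < k" "j < l" | "i < k" "l < j" | "k < i" "j < l" | "k < i" "l < j"
      by linarith
    then show ?thesis
    proof cases
      assume "i = k"
      then show ?thesis using 1 by simp
    next
      assume "j = l"
      then show ?thesis by simp
    next
      assume "i < k" "j < l"
      then show ?thesis using ordered[of i k j l] that by simp
    next
      assume "i < k" "l < j"
      then show ?thesis using ordered[of i k l j] that by simp
    next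
      assume "k < i" "j < l"
      then show ?thesis using ordered[of k i j l] that 1 2 by simp
    next
      assume "k < i" "l < j"
      then show ?thesis using ordered[of k i l j] that 1 2 by simp
    qed
  qed
  fix i j k l assume le: "i \<le> n" "j \<le> n" "k \<le> n" "l \<le> n"
  have "?T i k j l = ?T i j k l"
    using exchange[of i k l j] exchange[of i j l k] exchange[of i j k l] le sym2 by metis
  moreover have "?T i l k j = ?T i j k l" using exchange le by metis
  ultimately have "3 * ?T i j k l = 0"
    using bianchi[of "unit_vec i" "unit_vec j" "unit_vec k" "unit_vec l"] sym2 by simp
  then show "?T i j k l = 0" using three by simp
qed

section \<open>The ideal is spanned by pencil quadrics\<close>

lemma pscale_2: "pscale 2 p = p + (p :: ('i, 'k::comm_ring_1) mpol)"
  by (rule poly_mapping_eqI) (simp only: lookup_pscale lookup_add mult_2)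

lemma sum_mult_unit_vec:
  "a \<le> n \<Longrightarrow> (\<Sum>i\<le>(n::nat). f i * unit_vec i a) = (f a :: 'k::comm_ring_1)"
  by (simp add: unit_vec_def if_distrib sum.delta' cong: if_cong)

text \<open>
  Pencil quadrics are quadratic in \<open>a\<close> and in \<open>b\<close>. The second difference in both of them is twice the
  quadric below.
\<close>

lemma polarized_pencil_quadric_in_span:
  assumes two: "(2::'k::field) \<noteq> 0"
  shows "pscale 2 (bracket n a a' * bracket n b b') - bracket n a b * bracket n a' b'
    - bracket n a b' * bracket n a' b
    \<in> pvec.span {pencil_quadric n a b | a b :: nat \<Rightarrow> 'k. True}" (is "?P a a' b b' \<in> ?S")
proof -
  let ?D = "\<lambda>a a' b. pencil_quadric n (a + a') b - pencil_quadric n a b - pencil_quadric n a' b"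
  have D: "?D a a' b \<in> ?S" for a a' b
    by (intro pvec.span_diff pvec.span_base) blast+
  have "?D a a' (b + b') - ?D a a' b - ?D a a' b' = ?P a a' b b' + ?P a a' b b'"
    unfolding pencil_quadric_def bracket_add_left bracket_add_right power2_eq_square
    using bracket_commute[of n a' a] bracket_commute[of n b' b]
    by (simp add: pscale_2 algebra_simps)
  also have "\<dots> = pscale 2 (?P a a' b b')" by (simp only: pscale_2)
  finally have eq: "?D a a' (b + b') - ?D a a' b - ?D a a' b' = pscale 2 (?P a a' b b')" .
  have "?D a a' (b + b') - ?D a a' b - ?D a a' b' \<in> ?S" by (intro pvec.span_diff[OF _ D] D)
  then have "pscale 2 (?P a a' b b') \<in> ?S" by (simp only: eq)
  then have "pscale (1 / 2) (pscale 2 (?P a a' b b')) \<in> ?S" by (rule pvec.span_scale)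
  then show ?thesis using two by simp
qed

text \<open>
  Write \<open>T\<close> for the curvature tensor of \<open>Q\<close> and \<open>x\<^sub>i\<^sub>j\<close> for the coordinates. The sum \<open>R\<close> of all
  \<open>T\<^sub>i\<^sub>j\<^sub>k\<^sub>l x\<^sub>i\<^sub>j x\<^sub>k\<^sub>l\<close> equals \<open>8 Q\<close>, because each of the eight symmetries of the indices contributes \<open>T\<close> once
  to its curvature. Replacing \<open>x\<^sub>i\<^sub>j x\<^sub>k\<^sub>l\<close> by the polarised pencil quadric
  \<open>2 x\<^sub>i\<^sub>j x\<^sub>k\<^sub>l - x\<^sub>i\<^sub>k x\<^sub>j\<^sub>l - x\<^sub>i\<^sub>l x\<^sub>j\<^sub>k\<close> multiplies \<open>R\<close> by \<open>3\<close>: after renaming indices this is the Bianchi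
  identity. Hence \<open>24 Q\<close> is a combination of pencil quadrics.
\<close>

lemma veronese_ideal_2_eq_span:
  assumes two: "(2::'k::field) \<noteq> 0" and three: "(3::'k) \<noteq> 0"
  shows "veronese_ideal_2 n = pvec.span {pencil_quadric n a b | a b :: nat \<Rightarrow> 'k. True}" (is "_ = ?S")
proof (intro equalityI subsetI)
  have "pvec.subspace (veronese_ideal_2 n :: (nat multiset, 'k) mpol set)"
    by (auto simp: pvec.subspace_def mem_veronese_ideal_2 peval_add peval_pscale
        intro: forms_add forms_pscale)
  then show "Q \<in> veronese_ideal_2 n" if "Q \<in> ?S" for Q
    using pvec.span_minimal[of "{pencil_quadric n a b | a b. True}"] pencil_quadric_in_ideal that
    by blast
next
  fix Q :: "(nat multiset, 'k) mpol" assume Q: "Q \<in> veronese_ideal_2 n"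
  interpret curvature_form "curvature n Q" by (rule curvature_form_veronese_ideal[OF two Q])
  let ?T = "\<lambda>i j k l. curvature n Q (unit_vec i) (unit_vec j) (unit_vec k) (unit_vec l)"
  let ?x = "\<lambda>i j. bracket n (unit_vec i) (unit_vec j) :: (nat multiset, 'k) mpol"
  define R where "R = (\<Sum>i\<le>n. \<Sum>j\<le>n. \<Sum>k\<le>n. \<Sum>l\<le>n. pscale (?T i j k l) (?x i j * ?x k l))"
  define R' where "R' = (\<Sum>i\<le>n. \<Sum>j\<le>n. \<Sum>k\<le>n. \<Sum>l\<le>n. pscale (?T i j k l)
    (pscale 2 (?x i j * ?x k l) - ?x i k * ?x j l - ?x i l * ?x j k))"
  have "R' \<in> ?S" unfolding R'_def
    by (intro pvec.span_sum pvec.span_scale polarized_pencil_quadric_in_span two)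
  have R'_R: "R' = pscale 3 R"
  proof -
    have 1: "R' = (\<Sum>i\<le>n. \<Sum>j\<le>n. \<Sum>k\<le>n. \<Sum>l\<le>n. pscale (2 * ?T i j k l) (?x i j * ?x k l))
        - (\<Sum>i\<le>n. \<Sum>j\<le>n. \<Sum>k\<le>n. \<Sum>l\<le>n. pscale (?T i j k l) (?x i k * ?x j l))
        - (\<Sum>i\<le>n. \<Sum>j\<le>n. \<Sum>k\<le>n. \<Sum>l\<le>n. pscale (?T i j k l) (?x i l * ?x j k))"
      unfolding R'_def sum_subtractf[symmetric]
      by (intro sum.cong refl poly_mapping_eqI) (simp add: lookup_minus algebra_simps)
    have 2: "(\<Sum>i\<le>n. \<Sum>j\<le>n. \<Sum>k\<le>n. \<Sum>l\<le>n. pscale (?T i j k l) (?x i k * ?x j l))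
        = (\<Sum>i\<le>n. \<Sum>j\<le>n. \<Sum>k\<le>n. \<Sum>l\<le>n. pscale (?T i k j l) (?x i j * ?x k l))"
      by (rule sum.cong[OF refl], rule sum.swap)
    have 3: "(\<Sum>i\<le>n. \<Sum>j\<le>n. \<Sum>k\<le>n. \<Sum>l\<le>n. pscale (?T i j k l) (?x i l * ?x j k))
        = (\<Sum>i\<le>n. \<Sum>j\<le>n. \<Sum>k\<le>n. \<Sum>l\<le>n. pscale (?T i l k j) (?x i j * ?x k l))"
    proof (rule sum.cong[OF refl])
      fix i
      let ?f = "\<lambda>j k l. pscale (?T i j k l) (?x i l * ?x j k)"
      have "(\<Sum>j\<le>n. \<Sum>k\<le>n. \<Sum>l\<le>n. ?f j k l) = (\<Sum>k\<le>n. \<Sum>j\<le>n. \<Sum>l\<le>n. ?f j k l)"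
        by (rule sum.swap)
      also have "\<dots> = (\<Sum>k\<le>n. \<Sum>l\<le>n. \<Sum>j\<le>n. ?f j k l)"
        by (rule sum.cong[OF refl], rule sum.swap)
      also have "\<dots> = (\<Sum>l\<le>n. \<Sum>k\<le>n. \<Sum>j\<le>n. ?f j k l)"
        by (rule sum.swap)
      finally show "(\<Sum>j\<le>n. \<Sum>k\<le>n. \<Sum>l\<le>n. ?f j k l)
          = (\<Sum>j\<le>n. \<Sum>k\<le>n. \<Sum>l\<le>n. pscale (?T i l k j) (?x i j * ?x k l))"
        by (simp add: bracket_commute[of n "unit_vec l" "unit_vec k" for l k])
    qed
    have three_T: "3 * ?T i j k l = 2 * ?T i j k l - ?T i k j l - ?T i l k j" for i j k l
    proof -
      have "?T i k j l + ?T i l k j = - ?T i j k l"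
        using bianchi[of "unit_vec i" "unit_vec j" "unit_vec k" "unit_vec l"] sym2
        by (simp add: add_eq_0_iff2 add.assoc)
      then show ?thesis by (simp add: algebra_simps)
    qed
    show ?thesis
      unfolding 1 2 3 R_def sum_subtractf[symmetric] pvec.scale_sum_right
      by (simp only: pvec.scale_scale three_T pvec.scale_left_diff_distrib)
  qed
  have "curvature n R (unit_vec a) (unit_vec b) (unit_vec c) (unit_vec d) = 8 * ?T a b c d"
    if le: "a \<le> n" "b \<le> n" "c \<le> n" "d \<le> n" for a b c d
  proof -
    let ?\<delta> = "\<lambda>i j. unit_vec i j :: 'k"
    let ?t = "\<lambda>a b c d i j k l. ?T i j k l * ?\<delta> i a * ?\<delta> j b * ?\<delta> k c * ?\<delta> l d"
    have "curvature n R (unit_vec a) (unit_vec b) (unit_vec c) (unit_vec d) =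
      (\<Sum>i\<le>n. \<Sum>j\<le>n. \<Sum>k\<le>n. \<Sum>l\<le>n. ?T i j k l *
        ((?\<delta> i a * ?\<delta> j b + ?\<delta> i b * ?\<delta> j a) * (?\<delta> k c * ?\<delta> l d + ?\<delta> k d * ?\<delta> l c)
        + (?\<delta> i c * ?\<delta> j d + ?\<delta> i d * ?\<delta> j c) * (?\<delta> k a * ?\<delta> l b + ?\<delta> k b * ?\<delta> l a)))"
      by (simp only: R_def curvature_sum curvature_pscale curvature_mult_brackets dot_unit_vec le)
    also have "\<dots> = (\<Sum>i\<le>n. \<Sum>j\<le>n. \<Sum>k\<le>n. \<Sum>l\<le>n.
        ?t a b c d i j k l + ?t a b d c i j k l + ?t b a c d i j k l + ?t b a d c i j k l
        + ?t c d a b i j k l + ?t c d b a i j k l + ?t d c a b i j k l + ?t d c b a i j k l)"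
      by (intro sum.cong refl) (simp add: distrib_left distrib_right mult.assoc)
    also have "\<dots> = ?T a b c d + ?T a b d c + ?T b a c d + ?T b a d c
        + ?T c d a b + ?T c d b a + ?T d c a b + ?T d c b a"
      by (simp only: sum.distrib sum_mult_unit_vec le)
    also have "\<dots> = 8 * ?T a b c d"
      using sym1 sym2 pair by simp
    finally show ?thesis .
  qed
  moreover have "R \<in> forms (multisets_of_size {..n} 2) 2"
    unfolding R_def by (intro forms_sum forms_pscale mult_brackets_in_forms)
  then have "R - pscale 8 Q \<in> forms (multisets_of_size {..n} 2) 2"
    using Q by (intro forms_diff forms_pscale) (auto simp: mem_veronese_ideal_2)
  ultimately have "R - pscale 8 Q = 0"
    by (intro form_eq_0_if_curvature_eq_0[OF two]) (simp_all add: curvature_diff curvature_pscale)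
  then have "R' = pscale 24 Q" using R'_R by simp
  moreover have "(24::'k) = 2 * 2 * 2 * 3" by simp
  then have "(24::'k) \<noteq> 0" using two three by (metis mult_eq_0_iff)
  ultimately have "Q = pscale (1 / 24) R'" by simp
  then show "Q \<in> ?S" using \<open>R' \<in> ?S\<close> pvec.span_scale by metis
qed

section \<open>Quadrics of rank at most three\<close>

lemma pscale_eq_mult: "pscale c p = Poly_Mapping.single {#} c * p"
  by (simp add: pscale_def mult_map_scale_conv_mult)

lemma mult_linear_forms: "x \<in> forms I 1 \<Longrightarrow> y \<in> forms I 1 \<Longrightarrow> x * y \<in> forms I 2"
  using forms_mult[of x I 1 y 1] by (simp add: numeral_2_eq_2)

text \<open>
  With \<open>\<iota>\<^sup>2 = -1\<close> and \<open>h = 1/2\<close>, the product \<open>xy\<close> is \<open>(h (x + y))\<^sup>2 + (h \<iota> (x - y))\<^sup>2\<close>.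
\<close>

lemma product_minus_square_eq_sum_of_squares:
  fixes x y z :: "('i, 'k::alg_closed_field) mpol"
  assumes two: "(2::'k) \<noteq> 0" and xyz: "x \<in> forms I 1" "y \<in> forms I 1" "z \<in> forms I 1"
  obtains l where "\<And>i. l i \<in> forms I 1" "x * y - z\<^sup>2 = (\<Sum>i<3::nat. (l i)\<^sup>2)"
proof -
  obtain \<iota> :: 'k where \<iota>: "\<iota>\<^sup>2 = - 1" using nth_root_exists[of 2 "- 1"] by auto
  define h i :: "('i, 'k) mpol"
    where "h = Poly_Mapping.single {#} (1 / 2)" and "i = Poly_Mapping.single {#} \<iota>"
  define l where "l = (\<lambda>m::nat. if m = 0 then h * (x + y) else if m = 1 then h * (i * (x - y)) else i * z)"
  have i: "i * i = - 1"
    using \<iota> by (simp add: i_def mult_single power2_eq_square single_uminus)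
  have "2 * h = Poly_Mapping.single {#} (2::'k) * h" by simp
  also have "\<dots> = 1" using two unfolding h_def by (simp add: mult_single del: single_numeral)
  finally have h: "2 * h = 1" .
  have "(\<Sum>m<3::nat. (l m)\<^sup>2) = h * h * ((x + y) * (x + y)) + h * h * (i * i) * ((x - y) * (x - y)) + i * i * (z * z)"
    by (simp add: l_def numeral_3_eq_3 power2_eq_square mult_ac)
  also have "\<dots> = (2 * h) * (2 * h) * (x * y) - z * z"
    unfolding i by (simp add: algebra_simps)
  finally have "x * y - z\<^sup>2 = (\<Sum>m<3::nat. (l m)\<^sup>2)" by (simp add: h power2_eq_square)
  moreover have "l m \<in> forms I 1" for m
    unfolding l_def h_def i_def pscale_eq_mult[symmetric]
    using xyz by (auto intro!: forms_pscale forms_add forms_diff)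
  ultimately show thesis using that by blast
qed

definition sum_of_squares :: "'i set \<Rightarrow> nat \<Rightarrow> ('i, 'k::field) mpol \<Rightarrow> bool" where
  "sum_of_squares I k Q \<longleftrightarrow> (\<exists>l. (\<forall>i<k. l i \<in> forms I 1) \<and> Q = (\<Sum>i<k. (l i)\<^sup>2))"

lemma quadric_rank_eq_Least: "quadric_rank I Q = (LEAST k. sum_of_squares I k Q)"
  by (simp add: quadric_rank_def sum_of_squares_def)

lemma sum_of_squares_add:
  assumes "sum_of_squares I k Q" "sum_of_squares I k' Q'"
  shows "sum_of_squares I (k + k') (Q + Q')"
proof -
  obtain l l' where l: "\<forall>i<k. l i \<in> forms I 1" "Q = (\<Sum>i<k. (l i)\<^sup>2)"
      and l': "\<forall>i<k'. l' i \<in> forms I 1" "Q' = (\<Sum>i<k'. (l' i)\<^sup>2)"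
    using assms unfolding sum_of_squares_def by blast
  let ?l = "\<lambda>i. if i < k then l i else l' (i - k)"
  have "(\<Sum>i<k + k'. (?l i)\<^sup>2) = (\<Sum>i<k. (?l i)\<^sup>2) + (\<Sum>i=k..<k + k'. (?l i)\<^sup>2)"
    unfolding lessThan_atLeast0 by (rule sum.atLeastLessThan_concat[symmetric]) simp_all
  also have "(\<Sum>i=k..<k + k'. (?l i)\<^sup>2) = (\<Sum>i<k'. (?l (i + k))\<^sup>2)"
    using sum.shift_bounds_nat_ivl[of "\<lambda>i. (?l i)\<^sup>2" 0 k k'] by (simp add: lessThan_atLeast0 add.commute)
  finally have "Q + Q' = (\<Sum>i<k + k'. (?l i)\<^sup>2)" using l l' by simp
  moreover have "\<forall>i<k + k'. ?l i \<in> forms I 1" using l l' by auto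
  ultimately show ?thesis unfolding sum_of_squares_def by (intro exI[of _ ?l] conjI)
qed

text \<open>
  The rank is defined as a least number, which is meaningful only because some representation exists.
  Monomials have one by the previous identity, and representations can be concatenated.
\<close>

lemma ex_sum_of_squares:
  fixes Q :: "('i, 'k::alg_closed_field) mpol"
  assumes two: "(2::'k) \<noteq> 0" and Q: "Q \<in> forms I 2"
  shows "\<exists>k. sum_of_squares I k Q"
proof -
  have monomial: "\<exists>k. sum_of_squares I k (Poly_Mapping.single m c)" if m: "m \<in> multisets_of_size I 2" for m and c :: 'k
  proof -
    obtain i j where ij: "i \<in> I" "j \<in> I" "m = {#i, j#}" using m by (auto simp: mem_multisets_of_size_2)
    have "Poly_Mapping.single {#i#} c \<in> forms I 1" "Poly_Mapping.single {#j#} (1::'k) \<in> forms I 1"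
      using ij by (auto intro!: forms_single simp: multisets_of_size_def)
    from product_minus_square_eq_sum_of_squares[OF two this forms_0]
    obtain l where "\<And>i. l i \<in> forms I 1" "Poly_Mapping.single {#i#} c * Poly_Mapping.single {#j#} 1 - 0\<^sup>2
        = (\<Sum>i<3::nat. (l i)\<^sup>2)" by metis
    then have "sum_of_squares I 3 (Poly_Mapping.single m c)"
      unfolding sum_of_squares_def ij by (intro exI[of _ l]) (simp add: mult_single add_mset_commute[of i])
    then show ?thesis by blast
  qed
  have "\<exists>k. sum_of_squares I k (\<Sum>m\<in>A. Poly_Mapping.single m (Poly_Mapping.lookup Q m))"
    if "finite A" "A \<subseteq> multisets_of_size I 2" for A
    using that
  proof (induction A rule: finite_induct)
    case empty
    show ?case by (rule exI[of _ 0]) (simp add: sum_of_squares_def)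
  next
    case (insert m A)
    then obtain k k' where "sum_of_squares I k (Poly_Mapping.single m (Poly_Mapping.lookup Q m))"
        "sum_of_squares I k' (\<Sum>m\<in>A. Poly_Mapping.single m (Poly_Mapping.lookup Q m))"
      using monomial by (metis insert_subset)
    from sum_of_squares_add[OF this] show ?case using insert.hyps by auto
  qed
  from this[of "Poly_Mapping.keys Q"] show ?thesis
    using Q mpol_sum_single[of Q] by (simp add: forms_def)
qed

lemma quadric_rank_le_3_iff:
  fixes Q :: "('i, 'k::alg_closed_field) mpol"
  assumes two: "(2::'k) \<noteq> 0" and Q: "Q \<in> forms I 2"
  shows "quadric_rank I Q \<le> 3 \<longleftrightarrow>
    (\<exists>x\<in>forms I 1. \<exists>y\<in>forms I 1. \<exists>z\<in>forms I 1. Q = x * y - z\<^sup>2)"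
proof
  assume le: "quadric_rank I Q \<le> 3"
  have "sum_of_squares I (quadric_rank I Q) Q"
    unfolding quadric_rank_eq_Least by (rule LeastI_ex[OF ex_sum_of_squares[OF two Q]])
  then obtain r where r: "r \<le> 3" "sum_of_squares I r Q" using le by blast
  then obtain l where l: "\<And>i. i < r \<Longrightarrow> l i \<in> forms I 1" "Q = (\<Sum>i<r. (l i)\<^sup>2)"
    unfolding sum_of_squares_def by blast
  define p where "p i = (if i < r then l i else 0)" for i
  have p: "p i \<in> forms I 1" for i using l by (simp add: p_def)
  have "Q = (\<Sum>i<r. (p i)\<^sup>2)" unfolding l(2) by (simp add: p_def)
  also have "\<dots> = (\<Sum>i<3. (p i)\<^sup>2)"
    using r by (intro sum.mono_neutral_left) (auto simp: p_def)
  finally have Q3: "Q = p 0 * p 0 + p 1 * p 1 + p 2 * p 2"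
    by (simp add: numeral_3_eq_3 numeral_2_eq_2 power2_eq_square)
  obtain \<iota> :: 'k where \<iota>: "\<iota>\<^sup>2 = - 1" using nth_root_exists[of 2 "- 1"] by auto
  define i :: "('i, 'k) mpol" where "i = Poly_Mapping.single {#} \<iota>"
  have i: "i * i = - 1"
    using \<iota> by (simp add: i_def mult_single power2_eq_square single_uminus)
  \<comment> \<open>Padding with zeros gives exactly three squares, of which the first two sum to a product.\<close>
  have "(p 0 + i * p 1) * (p 0 - i * p 1) - (i * p 2)\<^sup>2
      = p 0 * p 0 - (i * i) * (p 1 * p 1) - (i * i) * (p 2 * p 2)"
    by (simp add: algebra_simps power2_eq_square)
  then have "Q = (p 0 + i * p 1) * (p 0 - i * p 1) - (i * p 2)\<^sup>2" unfolding Q3 i by simp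
  moreover have "p 0 + i * p 1 \<in> forms I 1" "p 0 - i * p 1 \<in> forms I 1" "i * p 2 \<in> forms I 1"
    unfolding i_def pscale_eq_mult[symmetric]
    by (intro forms_add forms_diff forms_pscale p)+
  ultimately show "\<exists>x\<in>forms I 1. \<exists>y\<in>forms I 1. \<exists>z\<in>forms I 1. Q = x * y - z\<^sup>2" by blast
next
  assume "\<exists>x\<in>forms I 1. \<exists>y\<in>forms I 1. \<exists>z\<in>forms I 1. Q = x * y - z\<^sup>2"
  then obtain l where "\<And>i. l i \<in> forms I 1" "Q = (\<Sum>i<3::nat. (l i)\<^sup>2)"
    using product_minus_square_eq_sum_of_squares[OF two] by metis
  then have "sum_of_squares I 3 Q" unfolding sum_of_squares_def by (intro exI[of _ l]) simp
  then show "quadric_rank I Q \<le> 3" unfolding quadric_rank_eq_Least by (rule Least_le)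
qed

lemma linear_form_veronese_quadratic:
  fixes l :: "(nat multiset, 'k::field) mpol"
  assumes l: "l \<in> forms (multisets_of_size {..n} 2) 1"
  shows "quadratic (\<lambda>v. peval l (veronese_vec {..n} 2 v))"
proof -
  have "quadratic (\<lambda>v. Poly_Mapping.lookup l m * (\<Prod>p\<in>#m. veronese_vec {..n} 2 v p))"
    if m: "m \<in> Poly_Mapping.keys l" for m
  proof -
    have "m \<in> multisets_of_size (multisets_of_size {..n} 2) 1" using m l by (auto simp: forms_def)
    then obtain p where p: "p \<in> multisets_of_size {..n} 2" "m = {#p#}"
      unfolding mem_multisets_of_size_1 by blast
    then have "(\<Prod>p\<in>#m. veronese_vec {..n} 2 v p) = (\<Prod>i\<in>#p. v i)" for v :: "nat \<Rightarrow> 'k"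
      by (simp add: veronese_vec_def)
    then show ?thesis using quadratic_cmult[OF quadratic_monomial[OF p(1)]] by simp
  qed
  then show ?thesis unfolding peval_def by (intro quadratic_sum)
qed

text \<open>
  Linear forms on the symmetric square are quadratic forms on the vector space.
\<close>

lemma linear_form_eq_0_if_eq_0_on_veronese:
  fixes l :: "(nat multiset, 'k::field) mpol"
  assumes two: "(2::'k) \<noteq> 0" and l: "l \<in> forms (multisets_of_size {..n} 2) 1"
    and 0: "\<And>v. peval l (veronese_vec {..n} 2 v) = 0"
  shows "l = 0"
proof (rule poly_mapping_eqI)
  fix M
  have diff: "peval l (y - z) = peval l y - peval l z" for y z
    using peval_linear_form_add[OF l, of "y - z" z] by (simp add: algebra_simps)
  have "Poly_Mapping.lookup l M = 0" if M: "M \<in> multisets_of_size (multisets_of_size {..n} 2) 1"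
  proof -
    obtain p where p: "p \<in> multisets_of_size {..n} 2" and "M = {#p#}"
      using M unfolding mem_multisets_of_size_1 by blast
    then obtain i j where ij: "i \<le> n" "j \<le> n" "M = {#{#i, j#}#}"
      by (auto simp: mem_multisets_of_size_2)
    have "peval l (sym_prod n (unit_vec i) (unit_vec j)) = 0"
      by (simp only: sym_prod_def diff 0 diff_self)
    then have "peval l (unit_vec {#i, j#}) = 0"
      using two peval_fscale[OF l] by (simp add: sym_prod_unit_vec ij split: if_splits)
    moreover have "peval l (unit_vec p) = Poly_Mapping.lookup l {#p#}" for p
    proof -
      have "peval l (unit_vec p) = (\<Sum>m\<in>Poly_Mapping.keys l. if m = {#p#} then Poly_Mapping.lookup l m else 0)"
        unfolding peval_def
      proof (rule sum.cong[OF refl])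
        fix m assume "m \<in> Poly_Mapping.keys l"
        then have "m \<in> multisets_of_size (multisets_of_size {..n} 2) 1" using l by (auto simp: forms_def)
        then obtain p' where "m = {#p'#}" unfolding mem_multisets_of_size_1 by blast
        then show "Poly_Mapping.lookup l m * (\<Prod>i\<in>#m. unit_vec p i)
            = (if m = {#p#} then Poly_Mapping.lookup l m else 0)"
          by (simp add: unit_vec_def)
      qed
      then show ?thesis by (simp add: sum.delta in_keys_iff)
    qed
    ultimately show ?thesis by (simp add: ij)
  qed
  then show "Poly_Mapping.lookup l M = Poly_Mapping.lookup 0 M"
    using l by (auto simp: forms_def in_keys_iff)
qed

lemma linear_form_eqI:
  fixes l :: "(nat multiset, 'k::field) mpol"
  assumes "(2::'k) \<noteq> 0" "l \<in> forms (multisets_of_size {..n} 2) 1" "l' \<in> forms (multisets_of_size {..n} 2) 1"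
    and "\<And>v. peval l (veronese_vec {..n} 2 v) = peval l' (veronese_vec {..n} 2 v)"
  shows "l = l'"
  using linear_form_eq_0_if_eq_0_on_veronese[of "l - l'" n] assms by (simp add: forms_diff peval_diff)

text \<open>
  Vectors are functions on all natural numbers, of which only the coordinates up to \<open>n\<close> matter.
  Truncation is the projection to these.
\<close>

definition truncate :: "nat \<Rightarrow> (nat \<Rightarrow> 'k::zero) \<Rightarrow> nat \<Rightarrow> 'k" where
  "truncate n v = (\<lambda>i. if i \<le> n then v i else 0)"

lemma sum_apply: "(\<Sum>i\<in>A. f i) j = (\<Sum>i\<in>A. f i j :: 'k::comm_monoid_add)"
  by (induction A rule: infinite_finite_induct) auto

lemma eq_sum_unit_vec:
  assumes "finite M" and t: "\<And>m. m \<notin> M \<Longrightarrow> t m = (0 :: 'k::field)"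
  shows "t = (\<Sum>m\<in>M. fscale (t m) (unit_vec m))"
proof
  fix j
  have "(\<Sum>m\<in>M. fscale (t m) (unit_vec m)) j = (\<Sum>m\<in>M. if m = j then t j else 0)"
    unfolding sum_apply by (intro sum.cong refl) (auto simp: fscale_def unit_vec_def)
  then show "t j = (\<Sum>m\<in>M. fscale (t m) (unit_vec m)) j" using \<open>finite M\<close> t by simp
qed

lemma truncate_eq_sum: "truncate n v = (\<Sum>i\<le>n. fscale (v i) (unit_vec i :: nat \<Rightarrow> 'k::field))"
proof -
  have "truncate n v = (\<Sum>i\<le>n. fscale (truncate n v i) (unit_vec i))"
    by (rule eq_sum_unit_vec) (auto simp: truncate_def)
  also have "\<dots> = (\<Sum>i\<le>n. fscale (v i) (unit_vec i))"
    by (intro sum.cong refl) (simp add: truncate_def)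
  finally show ?thesis .
qed

lemma linear_functional_coordinates:
  assumes g: "linear_functional g" and "finite M" and t: "\<And>m. m \<notin> M \<Longrightarrow> t m = 0"
  shows "g t = (\<Sum>m\<in>M. g (unit_vec m) * (t m :: 'k::field))"
proof -
  have "g 0 = 0" using g fscale_0_left[of 0] unfolding linear_functional_def by (metis mult_zero_left)
  have "g (\<Sum>m\<in>A. fscale (t m) (unit_vec m)) = (\<Sum>m\<in>A. g (unit_vec m) * t m)" if "finite A" for A
    using that
  proof (induction A rule: finite_induct)
    case empty
    then show ?case using \<open>g 0 = 0\<close> by (simp only: sum.empty)
  next
    case (insert x F)
    then show ?case using g
      by (simp only: sum.insert not_False_eq_True linear_functional_def mult.commute)
  qed
  from this[OF \<open>finite M\<close>] show ?thesis
    using eq_sum_unit_vec[of M t] \<open>finite M\<close> t by metis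
qed

lemma linear_functional_truncate:
  "linear_functional a \<Longrightarrow> a (truncate n v) = dot n (\<lambda>i. a (unit_vec i)) v"
  using linear_functional_coordinates[of a "{..n}" "truncate n v"]
  by (simp add: truncate_def dot_def)

lemma veronese_vec_truncate: "veronese_vec {..n} 2 (truncate n v) = veronese_vec {..n} 2 v"
  by (rule veronese_vec_cong) (simp add: truncate_def)

lemma linear_form_eq_bracket_if_square:
  fixes l :: "(nat multiset, 'k::field) mpol"
  assumes two: "(2::'k) \<noteq> 0" and l: "l \<in> forms (multisets_of_size {..n} 2) 1"
    and a: "linear_functional a" and sq: "\<And>v. peval l (veronese_vec {..n} 2 v) = (a v)\<^sup>2"
  shows "l = bracket n (\<lambda>i. a (unit_vec i)) (\<lambda>i. a (unit_vec i))"
proof (rule linear_form_eqI[OF two l bracket_in_forms])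
  fix v
  have "peval l (veronese_vec {..n} 2 v) = (a (truncate n v))\<^sup>2"
    using sq[of "truncate n v"] by (simp add: veronese_vec_truncate)
  then show "peval l (veronese_vec {..n} 2 v) =
      peval (bracket n (\<lambda>i. a (unit_vec i)) (\<lambda>i. a (unit_vec i))) (veronese_vec {..n} 2 v)"
    by (simp add: peval_bracket_veronese linear_functional_truncate[OF a] power2_eq_square)
qed

lemma polynomial_on_lines_dot: "polynomial_on_lines (dot n (a :: nat \<Rightarrow> 'k::field))"
  by (rule polynomial_on_lines_linear)
    (simp add: linear_functional_def dot_def fscale_def distrib_left sum.distrib sum_distrib_left mult_ac)

text \<open>
  Restricted to the Veronese variety, \<open>x\<close>, \<open>y\<close> and \<open>z\<close> are quadratic forms with \<open>xy = z\<^sup>2\<close>. Then they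
  are proportional, which makes the quadric zero, or \<open>x = a\<^sup>2\<close> and \<open>y = b\<^sup>2\<close> are squares of linear
  forms and \<open>z\<close> is \<open>ab\<close> up to sign.
\<close>

lemma rank_3_quadric_in_ideal_is_pencil_quadric:
  fixes x y z :: "(nat multiset, 'k::alg_closed_field) mpol"
  assumes two: "(2::'k) \<noteq> 0"
    and x: "x \<in> forms (multisets_of_size {..n} 2) 1"
    and y: "y \<in> forms (multisets_of_size {..n} 2) 1"
    and z: "z \<in> forms (multisets_of_size {..n} 2) 1"
    and Q: "x * y - z\<^sup>2 \<in> veronese_ideal_2 n"
  shows "\<exists>a b. x * y - z\<^sup>2 = pencil_quadric n a b"
proof (cases "x * y - z\<^sup>2 = 0")
  case True
  have "pencil_quadric n 0 0 = (0 :: (nat multiset, 'k) mpol)"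
    by (simp add: pencil_quadric_def bracket_def)
  with True show ?thesis by metis
next
  case False
  let ?q = "\<lambda>l v. peval l (veronese_vec {..n} 2 v) :: 'k"
  note quad = linear_form_veronese_quadratic
  have eq: "?q x v * ?q y v = (?q z v)\<^sup>2" for v
    using Q unfolding mem_veronese_ideal_2 by (simp add: peval_diff peval_mult peval_power)
  \<comment> \<open>If two of the quadratic forms are multiples of the third, so are the linear forms, and the
      quadric vanishes identically.\<close>
  have degenerate: False if "\<forall>v. ?q z v = \<alpha> * ?q l v \<and> ?q l' v = \<alpha>\<^sup>2 * ?q l v" "l * l' = x * y"
    "l \<in> forms (multisets_of_size {..n} 2) 1" "l' \<in> forms (multisets_of_size {..n} 2) 1" for \<alpha> l l'
  proof -
    have "z = pscale \<alpha> l"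
      using that by (intro linear_form_eqI[OF two z]) (auto simp: forms_pscale peval_pscale)
    moreover have "l' = pscale (\<alpha>\<^sup>2) l"
      using that by (intro linear_form_eqI[OF two]) (auto simp: forms_pscale peval_pscale)
    ultimately have "l * l' - z\<^sup>2 = 0"
      by (simp add: pscale_mult_left pscale_mult_right power2_eq_square)
    then show False using False that by simp
  qed
  obtain a where a: "linear_functional a" "\<And>v. ?q x v = (a v)\<^sup>2"
    using quadratic_product_eq_square[OF two quad[OF x] quad[OF y] quad[OF z] eq] degenerate[OF _ _ x y]
    by (metis (no_types, lifting))
  have eq': "?q y v * ?q x v = (?q z v)\<^sup>2" for v using eq[of v] by (simp add: mult.commute)
  obtain b where b: "linear_functional b" "\<And>v. ?q y v = (b v)\<^sup>2"
    using quadratic_product_eq_square[OF two quad[OF y] quad[OF x] quad[OF z] eq'] degenerate[OF _ mult.commute y x]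
    by (metis (no_types, lifting))
  define a' b' where "a' = (\<lambda>i. a (unit_vec i))" and "b' = (\<lambda>i. b (unit_vec i))"
  have x': "x = bracket n a' a'" and y': "y = bracket n b' b'"
    unfolding a'_def b'_def
    by (rule linear_form_eq_bracket_if_square[OF two x a] linear_form_eq_bracket_if_square[OF two y b])+
  have "(?q z v - dot n a' v * dot n b' v) * (?q z v + dot n a' v * dot n b' v) = 0" for v
    using eq[of v] by (simp add: x' y' peval_bracket_veronese power2_eq_square algebra_simps)
  then have "(\<forall>v. ?q z v - dot n a' v * dot n b' v = 0) \<or> (\<forall>v. ?q z v + dot n a' v * dot n b' v = 0)"
    by (intro polynomial_on_lines_no_zero_divisors polynomial_on_lines_diff polynomial_on_lines_add
        polynomial_on_lines_mult polynomial_on_lines_dot polynomial_on_lines_quadratic quad z)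
  then have "z = bracket n a' b' \<or> z = - bracket n a' b'"
  proof (elim disjE)
    assume 0: "\<forall>v. ?q z v - dot n a' v * dot n b' v = 0"
    have "z = bracket n a' b'"
      by (rule linear_form_eqI[OF two z bracket_in_forms]) (use 0 in \<open>simp add: peval_bracket_veronese\<close>)
    then show ?thesis ..
  next
    assume 0: "\<forall>v. ?q z v + dot n a' v * dot n b' v = 0"
    have "- bracket n a' b' \<in> forms (multisets_of_size {..n} 2) 1"
      using forms_diff[OF forms_0 bracket_in_forms] by simp
    then have "z = - bracket n a' b'"
      by (intro linear_form_eqI[OF two z]) (use 0 in \<open>simp_all add: peval_bracket_veronese peval_uminus eq_neg_iff_add_eq_0\<close>)
    then show ?thesis ..
  qed
  then have "z\<^sup>2 = (bracket n a' b')\<^sup>2" by auto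
  then have "x * y - z\<^sup>2 = pencil_quadric n a' b'" by (simp only: pencil_quadric_def x' y')
  then show ?thesis by blast
qed

lemma Phi3_eq:
  assumes two: "(2::'k::alg_closed_field) \<noteq> 0"
  shows "Phi3 n = {pvec.span {pencil_quadric n a b} | a b :: nat \<Rightarrow> 'k. pencil_quadric n a b \<noteq> 0}"
proof -
  have rank: "quadric_rank (multisets_of_size {..n} 2) Q \<le> 3 \<longleftrightarrow> (\<exists>a b. Q = pencil_quadric n a b)"
    if Q: "Q \<in> veronese_ideal_2 n" for Q :: "(nat multiset, 'k) mpol"
  proof -
    have "Q \<in> forms (multisets_of_size {..n} 2) 2" using Q by (simp add: mem_veronese_ideal_2)
    note iff = quadric_rank_le_3_iff[OF two this]
    show ?thesis unfolding iff
    proof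
      assume "\<exists>x\<in>forms (multisets_of_size {..n} 2) 1. \<exists>y\<in>forms (multisets_of_size {..n} 2) 1.
          \<exists>z\<in>forms (multisets_of_size {..n} 2) 1. Q = x * y - z\<^sup>2"
      then show "\<exists>a b. Q = pencil_quadric n a b"
        using Q rank_3_quadric_in_ideal_is_pencil_quadric[OF two] by metis
    next
      assume "\<exists>a b. Q = pencil_quadric n a b"
      then show "\<exists>x\<in>forms (multisets_of_size {..n} 2) 1. \<exists>y\<in>forms (multisets_of_size {..n} 2) 1.
          \<exists>z\<in>forms (multisets_of_size {..n} 2) 1. Q = x * y - z\<^sup>2"
        unfolding pencil_quadric_def using bracket_in_forms by blast
    qed
  qed
  show ?thesis
  proof (intro equalityI subsetI)
    fix L :: "(nat multiset, 'k) mpol set"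
    assume "L \<in> Phi3 n"
    then obtain Q where "L = pvec.span {Q}" "Q \<in> veronese_ideal_2 n" "Q \<noteq> 0"
        "quadric_rank (multisets_of_size {..n} 2) Q \<le> 3"
      unfolding Phi3_def by blast
    with rank show "L \<in> {pvec.span {pencil_quadric n a b} | a b. pencil_quadric n a b \<noteq> 0}" by blast
  next
    fix L :: "(nat multiset, 'k) mpol set"
    assume "L \<in> {pvec.span {pencil_quadric n a b} | a b. pencil_quadric n a b \<noteq> 0}"
    then obtain a b where ab: "L = pvec.span {pencil_quadric n a b}" "pencil_quadric n a b \<noteq> 0" by blast
    moreover have "quadric_rank (multisets_of_size {..n} 2) (pencil_quadric n a b) \<le> 3"
      using rank[OF pencil_quadric_in_ideal] by blast
    ultimately show "L \<in> Phi3 n" unfolding Phi3_def using pencil_quadric_in_ideal by blast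
  qed
qed

section \<open>The Pluecker cone\<close>

text \<open>
  Ignoring the coordinates beyond \<open>n\<close> makes this bilinear map on all vectors have its values in the
  Pluecker space, so that the multilinear algebra below needs no conditions on supports.
\<close>

definition pluecker_vec :: "nat \<Rightarrow> (nat \<Rightarrow> 'k::field) \<Rightarrow> (nat \<Rightarrow> 'k) \<Rightarrow> nat \<times> nat \<Rightarrow> 'k" where
  "pluecker_vec n u v = wedge (truncate n u) (truncate n v)"

lemma pluecker_vec_apply:
  "pluecker_vec n u v (i, j) = (if (i, j) \<in> pluecker_index n then u i * v j - u j * v i else 0)"
  by (auto simp: pluecker_vec_def wedge_def truncate_def pluecker_index_def)

lemma pluecker_vec_linear_right:
  "pluecker_vec n u (fscale x v + fscale y w) = fscale x (pluecker_vec n u v) + fscale y (pluecker_vec n u w)"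
  by (auto simp: fun_eq_iff pluecker_vec_apply fscale_def algebra_simps)

lemma pluecker_vec_scale_left: "pluecker_vec n (fscale x u) v = fscale x (pluecker_vec n u v)"
  by (auto simp: fun_eq_iff pluecker_vec_apply fscale_def algebra_simps)

lemma pluecker_vec_swap: "pluecker_vec n v u = fscale (-1) (pluecker_vec n u v)"
  by (auto simp: fun_eq_iff pluecker_vec_apply fscale_def algebra_simps)

lemma pluecker_vec_truncate: "pluecker_vec n (truncate n u) v = pluecker_vec n u v"
  by (auto simp: fun_eq_iff pluecker_vec_apply truncate_def pluecker_index_def)

lemma pluecker_vec_self: "pluecker_vec n u u = 0" "pluecker_vec n (u + u) u = 0"
    "pluecker_vec n u (u + u) = 0" "pluecker_vec n (u + u) (u + u) = 0"
  by (auto simp: fun_eq_iff pluecker_vec_apply algebra_simps)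

lemma truncate_id: "v \<in> coord_space {..n} \<Longrightarrow> truncate n v = v"
  by (auto simp: truncate_def coord_space_def fun_eq_iff)

lemma truncate_in_coord_space: "truncate n v \<in> coord_space {..n}"
  by (simp add: truncate_def coord_space_def)

lemma wedge_fscale: "wedge (fscale x u) (fscale y u) = 0"
  by (auto simp: wedge_def fscale_def fun_eq_iff)

text \<open>
  A dependent pair consists of two multiples of one vector, whose wedge product vanishes.
\<close>

lemma span_in_grassmannian_if_wedge_neq_0:
  assumes u: "u \<in> coord_space {..n}" and v: "v \<in> coord_space {..n}" and w: "wedge u v \<noteq> 0"
  shows "fvec.span {u, v} \<in> grassmannian_lines n"
proof -
  have "u \<notin> fvec.span {v}"
    using w wedge_fscale[of _ v 1] by (auto simp: fvec.span_singleton)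
  moreover have "v \<noteq> 0" using w wedge_fscale[of 1 u 0] by auto
  ultimately have "fvec.independent {u, v}" "u \<noteq> v"
    by (auto simp: fvec.independent_insert fvec.span_base)
  then have "fvec.dim {u, v} = 2" using fvec.dim_eq_card_independent[of "{u, v}"] by simp
  moreover have "fvec.span {u, v} \<subseteq> coord_space {..n}"
    using u v by (intro fvec.span_minimal subspace_coord_space) auto
  ultimately show ?thesis by (simp add: grassmannian_lines_def)
qed

lemma cone_pluecker: "cone (pluecker n) = {pluecker_vec n u v | u v. True} - {0}"
proof (intro equalityI subsetI)
  fix w assume "w \<in> cone (pluecker n)"
  then obtain u v where w: "w \<in> fvec.span {wedge u v}" "w \<noteq> 0" and "fvec.span {u, v} \<in> grassmannian_lines n"
    by (auto simp: cone_def pluecker_def)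
  then have uv: "u \<in> coord_space {..n}" "v \<in> coord_space {..n}"
    using fvec.span_superset[of "{u, v}"] by (auto simp: grassmannian_lines_def)
  obtain c where "w = fscale c (wedge u v)" using w by (auto simp: fvec.span_singleton)
  then have "w = pluecker_vec n (fscale c u) v"
    using uv by (simp add: pluecker_vec_scale_left) (simp add: pluecker_vec_def truncate_id)
  then show "w \<in> {pluecker_vec n u v | u v. True} - {0}" using w by blast
next
  fix w assume "w \<in> {pluecker_vec n u v | u v. True} - {0}"
  then obtain u v where w: "w = wedge (truncate n u) (truncate n v)" "w \<noteq> 0"
    by (auto simp: pluecker_vec_def)
  then have "fvec.span {w} \<in> pluecker n"
    unfolding pluecker_def
    using span_in_grassmannian_if_wedge_neq_0[OF truncate_in_coord_space truncate_in_coord_space] by blast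
  then show "w \<in> cone (pluecker n)" using w fvec.span_base[of w "{w}"] by (auto simp: cone_def)
qed

section \<open>Sections of O(2) on the Grassmannian\<close>

context
  fixes n :: nat and s :: "(nat \<times> nat \<Rightarrow> 'k::alg_closed_field) \<Rightarrow> 'k"
  assumes two: "(2::'k) \<noteq> 0"
    and s: "s \<in> global_sections (pluecker_index n) (pluecker n) 2"
begin

text \<open>
  The section as a function of two vectors spanning a line. For fixed \<open>u\<close>, the points \<open>u \<and> v\<close> with
  \<open>v\<close> in a plane lie on a line contained in the Grassmannian, unless they are multiples of one
  vector. Hence the function is a quadratic form in each of its arguments.
\<close>

definition biquadratic :: "(nat \<Rightarrow> 'k) \<Rightarrow> (nat \<Rightarrow> 'k) \<Rightarrow> 'k" where
  "biquadratic u v = s (pluecker_vec n u v)"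

text \<open>
  The polarisation in both arguments, \<open>a\<close> and \<open>b\<close> belonging to the first one and \<open>c\<close> and \<open>d\<close> to the
  second. Nullity is the equation \<open>a \<and> a = 0\<close>, so that sections of \<open>O(2)\<close> give curvature forms, just as
  the quadrics containing the Veronese variety do.
\<close>

definition bipolar :: "(nat \<Rightarrow> 'k) \<Rightarrow> (nat \<Rightarrow> 'k) \<Rightarrow> (nat \<Rightarrow> 'k) \<Rightarrow> (nat \<Rightarrow> 'k) \<Rightarrow> 'k" where
  "bipolar a b c d = polar (biquadratic (a + b)) c d - polar (biquadratic a) c d - polar (biquadratic b) c d"

lemma quadratic_biquadratic: "quadratic (biquadratic u)"
proof (rule quadratic_if_quadratic_on_planes[OF two])
  fix v w
  have "fscale x (pluecker_vec n u v) + fscale y (pluecker_vec n u w) \<in> cone (pluecker n) \<union> {0}" for x y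
    unfolding pluecker_vec_linear_right[symmetric] cone_pluecker by blast
  from global_section_quadratic_on_line[OF s this]
  show "\<exists>a b c. \<forall>x y. biquadratic u (fscale x v + fscale y w) = a * x\<^sup>2 + b * x * y + c * y\<^sup>2"
    by (simp add: biquadratic_def pluecker_vec_linear_right)
qed

lemma biquadratic_commute: "biquadratic u v = biquadratic v u"
proof -
  have "fscale x (pluecker_vec n u v) \<in> cone (pluecker n) \<union> {0}" for x
    unfolding pluecker_vec_scale_left[symmetric] cone_pluecker by blast
  from global_section_fscale[OF s _ this, of "-1"] show ?thesis
    by (simp add: biquadratic_def pluecker_vec_swap[of n v u])
qed

lemma biquadratic_truncate: "biquadratic (truncate n u) v = biquadratic u v"
  by (simp add: biquadratic_def pluecker_vec_truncate)

lemma bipolar_pair: "bipolar c d a b = bipolar a b c d"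
  unfolding bipolar_def polar_def
  using biquadratic_commute[of c] biquadratic_commute[of d] biquadratic_commute[of "c + d"] by simp

lemma curvature_form_bipolar: "curvature_form bipolar"
proof
  show "(2::'k) \<noteq> 0" by (rule two)
  fix a a' b c d :: "nat \<Rightarrow> 'k" and x :: 'k
  have "bipolar c d (a + a') b = bipolar c d a b + bipolar c d a' b"
    using quadratic_biquadratic by (simp add: bipolar_def quadratic_def)
  then show "bipolar (a + a') b c d = bipolar a b c d + bipolar a' b c d"
    by (simp only: bipolar_pair)
  have "bipolar c d (fscale x a) b = x * bipolar c d a b"
    using quadratic_biquadratic by (simp add: bipolar_def quadratic_def right_diff_distrib)
  then show "bipolar (fscale x a) b c d = x * bipolar a b c d"
    by (simp only: bipolar_pair)
  show "bipolar b a c d = bipolar a b c d" by (simp add: bipolar_def add.commute)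
  show "bipolar c d a b = bipolar a b c d" by (rule bipolar_pair)
  show "bipolar a a a a = 0"
    using global_section_0[OF s] by (simp only: bipolar_def polar_def biquadratic_def pluecker_vec_self) simp
qed

interpretation curvature_form bipolar by (rule curvature_form_bipolar)

lemma bipolar_diagonal: "bipolar u u v v = 4 * biquadratic u v"
proof -
  have double: "x + x = fscale 2 x" for x :: "nat \<Rightarrow> 'k" by (simp add: fscale_def fun_eq_iff)
  have "biquadratic u (v + v) = 4 * biquadratic u v" for u v
    unfolding double by (simp add: quadratic_scale[OF quadratic_biquadratic])
  moreover have "biquadratic (u + u) v = 4 * biquadratic u v" for u v
    using calculation[of v u] biquadratic_commute by metis
  ultimately show ?thesis by (simp add: bipolar_def polar_def)
qed

lemma bipolar_truncate: "bipolar (truncate n a) b c d = bipolar a b c d"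
proof -
  have "biquadratic (truncate n a + b) v = biquadratic (a + b) v" for v
  proof -
    have "truncate n (truncate n a + b) = truncate n (a + b)"
      by (auto simp: truncate_def fun_eq_iff)
    then show ?thesis using biquadratic_truncate by metis
  qed
  then show ?thesis by (simp add: bipolar_def polar_def biquadratic_truncate)
qed

lemma bipolar_expand:
  "bipolar a b c d = (\<Sum>i\<le>n. \<Sum>j\<le>n. \<Sum>k\<le>n. \<Sum>l\<le>n. a i * b j * c k * d l *
      bipolar (unit_vec i) (unit_vec j) (unit_vec k) (unit_vec l))"
proof -
  have "bipolar a b c d = bipolar (truncate n a) (truncate n b) (truncate n c) (truncate n d)"
    using bipolar_truncate sym1 sym2 pair by metis
  also have "\<dots> = (\<Sum>i\<le>n. a i * bipolar (unit_vec i) (truncate n b) (truncate n c) (truncate n d))"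
    by (simp only: truncate_eq_sum[of n a] sum1)
  also have "\<dots> = (\<Sum>i\<le>n. a i * (\<Sum>j\<le>n. b j *
      bipolar (unit_vec i) (unit_vec j) (truncate n c) (truncate n d)))"
    by (simp only: truncate_eq_sum[of n b] sum2)
  also have "\<dots> = (\<Sum>i\<le>n. a i * (\<Sum>j\<le>n. b j * (\<Sum>k\<le>n. c k *
      bipolar (unit_vec i) (unit_vec j) (unit_vec k) (truncate n d))))"
    by (simp only: truncate_eq_sum[of n c] sum3)
  also have "\<dots> = (\<Sum>i\<le>n. a i * (\<Sum>j\<le>n. b j * (\<Sum>k\<le>n. c k * (\<Sum>l\<le>n. d l *
      bipolar (unit_vec i) (unit_vec j) (unit_vec k) (unit_vec l)))))"
    by (simp only: truncate_eq_sum[of n d] sum4)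
  finally show ?thesis by (simp only: sum_distrib_left mult.assoc)
qed

text \<open>
  Multiplying out the minors and using multilinearity turns the right-hand side into
  \<open>2 T(u, u; v, v) - 2 T(u, v; u, v)\<close>, and \<open>T(u, v; u, v)\<close> is \<open>- T(u, u; v, v) / 2\<close> by the Bianchi
  identity.
\<close>

lemma biquadratic_eq_quadric_in_minors:
  "12 * biquadratic u v = (\<Sum>i\<le>n. \<Sum>j\<le>n. \<Sum>k\<le>n. \<Sum>l\<le>n.
      bipolar (unit_vec i) (unit_vec j) (unit_vec k) (unit_vec l) *
      ((u i * v k - u k * v i) * (u j * v l - u l * v j)))"
proof -
  let ?t = "\<lambda>i j k l. bipolar (unit_vec i) (unit_vec j) (unit_vec k) (unit_vec l)"
  have "(\<Sum>i\<le>n. \<Sum>j\<le>n. \<Sum>k\<le>n. \<Sum>l\<le>n. ?t i j k l * ((u i * v k - u k * v i) * (u j * v l - u l * v j)))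
      = (\<Sum>i\<le>n. \<Sum>j\<le>n. \<Sum>k\<le>n. \<Sum>l\<le>n. u i * u j * v k * v l * ?t i j k l
        - u i * v j * v k * u l * ?t i j k l - v i * u j * u k * v l * ?t i j k l
        + v i * v j * u k * u l * ?t i j k l)"
    by (intro sum.cong refl) (simp add: algebra_simps)
  also have "\<dots> = bipolar u u v v - bipolar u v v u - bipolar v u u v + bipolar v v u u"
    by (simp only: sum.distrib sum_subtractf bipolar_expand[of u u v v] bipolar_expand[of u v v u]
        bipolar_expand[of v u u v] bipolar_expand[of v v u u])
  also have "\<dots> = 3 * bipolar u u v v - (bipolar u u v v + 2 * bipolar u v u v)"
    using sym1 sym2 pair[of u u v v] by (simp add: algebra_simps)
  also have "\<dots> = 12 * biquadratic u v"
    unfolding bianchi_repeated by (simp add: bipolar_diagonal)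
  finally show ?thesis ..
qed

end

text \<open>
  The Pluecker coordinates as an antisymmetric family, indexed by arbitrary pairs.
\<close>

definition minor_form :: "nat \<Rightarrow> nat \<Rightarrow> (nat \<times> nat, 'k::field) mpol" where
  "minor_form i k = (if i < k then Poly_Mapping.single {#(i, k)#} 1
     else if k < i then Poly_Mapping.single {#(k, i)#} (-1) else 0)"

lemma minor_form_in_forms: "i \<le> n \<Longrightarrow> k \<le> n \<Longrightarrow> minor_form i k \<in> forms (pluecker_index n) 1"
  by (auto simp: minor_form_def pluecker_index_def multisets_of_size_def intro!: forms_single)

lemma peval_minor_form:
  "i \<le> n \<Longrightarrow> k \<le> n \<Longrightarrow> peval (minor_form i k) (pluecker_vec n u v) = u i * v k - u k * v i"
  by (auto simp: minor_form_def peval_single pluecker_vec_apply pluecker_index_def not_less)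

definition section_of_form :: "('i \<Rightarrow> 'k::field) set set \<Rightarrow> ('i, 'k) mpol \<Rightarrow> ('i \<Rightarrow> 'k) \<Rightarrow> 'k" where
  "section_of_form X F w = (if w \<in> cone X then peval F w else 0)"

lemma section_of_form_in_global_sections:
  fixes F :: "('i, 'k::field) mpol"
  assumes "F \<in> forms I d" shows "section_of_form X F \<in> global_sections I X d"
proof -
  have 1: "1 \<in> forms I 0" "peval 1 w = (1 :: 'k)" for w :: "'i \<Rightarrow> 'k"
    using peval_single[of "{#}" "1::'k" w] by (simp_all add: forms_def)
  show ?thesis unfolding global_sections_def
  proof (intro CollectI conjI ballI)
    fix p assume "p \<in> cone X"
    show "\<exists>a e H F' G. H \<in> forms I a \<and> F' \<in> forms I (d + e) \<and> G \<in> forms I e \<and> peval H p \<noteq> 0 \<and>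
        (\<forall>q\<in>cone X. peval H q \<noteq> 0 \<longrightarrow> peval G q \<noteq> 0 \<and> section_of_form X F q = peval F' q / peval G q)"
      by (rule exI[of _ 0], rule exI[of _ 0], rule exI[of _ 1], rule exI[of _ F], rule exI[of _ 1])
        (use assms 1 in \<open>simp add: section_of_form_def\<close>)
  qed (simp add: section_of_form_def)
qed

text \<open>
  Dividing the previous identity by \<open>12\<close> writes a section as a quadratic form in the Pluecker coordinates:
  the Grassmannian of lines is projectively normal in degree two.
\<close>

lemma global_sections_pluecker:
  assumes two: "(2::'k::alg_closed_field) \<noteq> 0" and three: "(3::'k) \<noteq> 0"
  shows "global_sections (pluecker_index n) (pluecker n) 2
    = section_of_form (pluecker n) ` (forms (pluecker_index n) 2 :: (nat \<times> nat, 'k) mpol set)"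
proof (intro equalityI subsetI)
  fix s :: "(nat \<times> nat \<Rightarrow> 'k) \<Rightarrow> 'k"
  assume s: "s \<in> global_sections (pluecker_index n) (pluecker n) 2"
  let ?t = "\<lambda>i j k l. bipolar n s (unit_vec i) (unit_vec j) (unit_vec k) (unit_vec l)"
  define F where "F = pscale (1 / 12) (\<Sum>i\<le>n. \<Sum>j\<le>n. \<Sum>k\<le>n. \<Sum>l\<le>n.
    pscale (?t i j k l) (minor_form i k * minor_form j l))"
  have F: "F \<in> forms (pluecker_index n) 2" unfolding F_def
    by (intro forms_pscale forms_sum mult_linear_forms minor_form_in_forms) auto
  have "(12::'k) = 2 * 2 * 3" by simp
  then have 12: "(12::'k) \<noteq> 0" using two three by (metis mult_eq_0_iff)
  have "s w = peval F w" if w: "w \<in> cone (pluecker n)" for w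
  proof -
    obtain u v where uv: "w = pluecker_vec n u v" using w unfolding cone_pluecker by blast
    have "12 * peval F w = (\<Sum>i\<le>n. \<Sum>j\<le>n. \<Sum>k\<le>n. \<Sum>l\<le>n.
        ?t i j k l * ((u i * v k - u k * v i) * (u j * v l - u l * v j)))"
      using 12 by (simp add: F_def peval_pscale peval_sum peval_mult uv peval_minor_form)
    also have "\<dots> = 12 * s w"
      unfolding biquadratic_eq_quadric_in_minors[OF two s, symmetric] by (simp add: biquadratic_def[OF two s] uv)
    finally show ?thesis using 12 by simp
  qed
  moreover have "s w = 0" if "w \<notin> cone (pluecker n)" for w
    using s that by (simp add: global_sections_def)
  ultimately have "s = section_of_form (pluecker n) F"
    by (auto simp: section_of_form_def fun_eq_iff)
  then show "s \<in> section_of_form (pluecker n) ` forms (pluecker_index n) 2" using F by blast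
qed (use section_of_form_in_global_sections in blast)

section \<open>The target of a complete linear system\<close>

definition form_pairing :: "'i set \<Rightarrow> nat \<Rightarrow> ('i, 'k::field) mpol \<Rightarrow> ('i multiset \<Rightarrow> 'k) \<Rightarrow> 'k" where
  "form_pairing I d F t = (\<Sum>m\<in>multisets_of_size I d. Poly_Mapping.lookup F m * t m)"

lemma form_pairing_veronese:
  assumes "finite I" "F \<in> forms I d"
  shows "form_pairing I d F (veronese_vec I d w) = peval F w"
  using assms peval_superset[of "multisets_of_size I d" F w]
  by (simp add: form_pairing_def veronese_vec_def forms_def finite_multisets_of_size)

lemma form_pairing_linear:
  "form_pairing I d F (t + t') = form_pairing I d F t + form_pairing I d F t'"
  "form_pairing I d F (fscale c t) = c * form_pairing I d F t"
  "form_pairing I d (F + G) t = form_pairing I d F t + form_pairing I d G t"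
  "form_pairing I d (pscale c F) t = c * form_pairing I d F t"
  by (simp_all add: form_pairing_def fscale_def lookup_add distrib_left distrib_right sum.distrib
      sum_distrib_left mult_ac)

lemma section_of_form_add: "section_of_form X (F + G) = section_of_form X F + section_of_form X G"
  by (auto simp: section_of_form_def peval_add fun_eq_iff)

lemma section_of_form_pscale: "section_of_form X (pscale c F) = fscale c (section_of_form X F)"
  by (auto simp: section_of_form_def peval_pscale fscale_def fun_eq_iff)

lemma ex_separating_functional:
  assumes "t \<notin> fvec.span S"
  shows "\<exists>g. linear_functional g \<and> (\<forall>w\<in>S. g w = 0) \<and> g t = (1 :: 'k::field)"
proof -
  interpret vs: vector_space_pair "fscale :: 'k \<Rightarrow> ('a \<Rightarrow> 'k) \<Rightarrow> 'a \<Rightarrow> 'k" "(*) :: 'k \<Rightarrow> 'k \<Rightarrow> 'k"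
    by unfold_locales (auto simp: algebra_simps)
  obtain B where B: "B \<subseteq> S" "fvec.independent B" "S \<subseteq> fvec.span B"
    using fvec.maximal_independent_subset[of S] by blast
  have tB: "t \<notin> fvec.span B" using assms fvec.span_mono[OF B(1)] by blast
  then have "fvec.independent (insert t B)" using B(2) by (simp add: fvec.independent_insert)
  from vs.linear_independent_extend[OF this, of "\<lambda>x. if x = t then 1 else 0"]
  obtain g where g: "Vector_Spaces.linear fscale (*) g" "\<And>x. x \<in> insert t B \<Longrightarrow> g x = (if x = t then 1 else 0)"
    by blast
  have "t \<notin> B" using tB fvec.span_base by blast
  then have gB: "g x = 0" if "x \<in> B" for x using g(2)[of x] that by auto
  have "g w = 0" if "w \<in> fvec.span B" for w
    using vs.linear_eq_0_on_span[OF g(1) gB that] .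
  moreover have "linear_functional g"
    using g(1) by (simp add: linear_functional_def vs.linear_add vs.linear_scale)
  ultimately show ?thesis using g(2)[of t] B(3) by auto
qed

text \<open>
  If all sections of \<open>O(d)\<close> come from forms of degree \<open>d\<close>, the pairing of forms with points of the
  Veronese space identifies the span of the Veronese image of \<open>X\<close> with the dual of the space of
  sections.
\<close>

context
  fixes I :: "'i set" and X :: "('i \<Rightarrow> 'k::field) set set" and d :: nat
    and H :: "(('i \<Rightarrow> 'k) \<Rightarrow> 'k) set" and W :: "('i multiset \<Rightarrow> 'k) set"
  assumes I: "finite I" and H: "H = section_of_form X ` forms I d"
    and W: "W = fvec.span (veronese_vec I d ` cone X)"
begin

text \<open>
  A section determines a form up to forms vanishing on \<open>X\<close>. The choice matters outside \<open>W\<close> only, and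
  it keeps the functional defined below linear in \<open>t\<close> on the whole function space.
\<close>

definition some_form :: "(('i \<Rightarrow> 'k) \<Rightarrow> 'k) \<Rightarrow> ('i, 'k) mpol" where
  "some_form s = (SOME F. F \<in> forms I d \<and> s = section_of_form X F)"

definition pairing_functional :: "('i multiset \<Rightarrow> 'k) \<Rightarrow> (('i \<Rightarrow> 'k) \<Rightarrow> 'k) \<Rightarrow> 'k" where
  "pairing_functional t = (\<lambda>s. if s \<in> H then form_pairing I d (some_form s) t else 0)"

lemma some_form:
  assumes "s \<in> H" shows "some_form s \<in> forms I d" "section_of_form X (some_form s) = s"
proof -
  have "\<exists>F. F \<in> forms I d \<and> s = section_of_form X F" using assms H by blast
  from someI_ex[OF this] have "some_form s \<in> forms I d \<and> s = section_of_form X (some_form s)"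
    unfolding some_form_def .
  then show "some_form s \<in> forms I d" "section_of_form X (some_form s) = s" by auto
qed

lemma linear_pairing_functional: "Vector_Spaces.linear fscale fscale pairing_functional"
  by unfold_locales (auto simp: pairing_functional_def form_pairing_linear fscale_apply fun_eq_iff)

lemma form_pairing_cong:
  assumes F: "F \<in> forms I d" "F' \<in> forms I d" "section_of_form X F = section_of_form X F'" and t: "t \<in> W"
  shows "form_pairing I d F t = form_pairing I d F' t"
  using t unfolding W
proof (induction rule: fvec.span_induct)
  case base
  show ?case
    by (auto simp: fvec.subspace_def form_pairing_linear) (simp_all add: form_pairing_def)
next
  case (step t)
  then obtain w where w: "w \<in> cone X" "t = veronese_vec I d w" by blast
  then show ?case using fun_cong[OF F(3), of w] by (simp add: form_pairing_veronese I F(1,2) section_of_form_def)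
qed

lemma pairing_functional_section:
  assumes "F \<in> forms I d" "t \<in> W"
  shows "pairing_functional t (section_of_form X F) = form_pairing I d F t"
proof -
  have "section_of_form X F \<in> H" using assms H by blast
  then show ?thesis
    using form_pairing_cong[OF _ assms(1) _ assms(2)] some_form by (simp add: pairing_functional_def)
qed

lemma pairing_functional_veronese:
  assumes "w \<in> cone X" shows "pairing_functional (veronese_vec I d w) = evaluation H w"
proof
  fix s
  show "pairing_functional (veronese_vec I d w) s = evaluation H w s"
  proof (cases "s \<in> H")
    case True
    then have "pairing_functional (veronese_vec I d w) s = section_of_form X (some_form s) w"
      using assms some_form(1) by (simp add: pairing_functional_def form_pairing_veronese I section_of_form_def)
    then show ?thesis using True by (simp add: some_form evaluation_def)
  qed (simp add: pairing_functional_def evaluation_def)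
qed

lemma pairing_functional_in_dual:
  assumes t: "t \<in> W" shows "pairing_functional t \<in> dual H"
  unfolding dual_def
proof (intro CollectI conjI ballI allI impI)
  fix s s' assume "s \<in> H" "s' \<in> H"
  then obtain F F' where F: "F \<in> forms I d" "F' \<in> forms I d" "s = section_of_form X F" "s' = section_of_form X F'"
    using H by blast
  then have "pairing_functional t (section_of_form X (F + F')) = pairing_functional t s + pairing_functional t s'"
    using t by (simp add: pairing_functional_section forms_add form_pairing_linear)
  then show "pairing_functional t (s + s') = pairing_functional t s + pairing_functional t s'"
    by (simp add: section_of_form_add F)
next
  fix c s assume "s \<in> H"
  then obtain F where F: "F \<in> forms I d" "s = section_of_form X F" using H by blast
  then have "pairing_functional t (section_of_form X (pscale c F)) = c * pairing_functional t s"
    using t by (simp add: pairing_functional_section forms_pscale form_pairing_linear)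
  then show "pairing_functional t (fscale c s) = c * pairing_functional t s"
    by (simp add: section_of_form_pscale F)
qed (simp add: pairing_functional_def)

lemma inj_on_pairing_functional: "inj_on pairing_functional W"
proof (rule inj_onI)
  fix t t' assume t: "t \<in> W" "t' \<in> W" and eq: "pairing_functional t = pairing_functional t'"
  have outside: "u m = 0" if "u \<in> W" "m \<notin> multisets_of_size I d" for u m
    using that(1) unfolding W
    by (induction rule: fvec.span_induct)
      (use that(2) in \<open>auto simp: fvec.subspace_def fscale_def veronese_vec_def\<close>)
  show "t = t'"
  proof
    fix m
    show "t m = t' m"
    proof (cases "m \<in> multisets_of_size I d")
      case True
      let ?F = "Poly_Mapping.single m (1::'k)"
      have "form_pairing I d ?F u = u m" for u
      proof -
        have "form_pairing I d ?F u = (\<Sum>m'\<in>multisets_of_size I d. if m = m' then u m' else 0)"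
          unfolding form_pairing_def by (intro sum.cong refl) (simp add: lookup_single when_def)
        then show ?thesis using True I by (simp add: finite_multisets_of_size)
      qed
      then show ?thesis
        using eq pairing_functional_section[of ?F] t True by (metis forms_single)
    next
      case False
      then show ?thesis using outside[OF t(1) False] outside[OF t(2) False] by simp
    qed
  qed
qed

text \<open>
  The values of \<open>\<phi>\<close> on monomials are the coordinates of the preimage \<open>t\<close>. If \<open>t\<close> were not in \<open>W\<close>, a linear
  functional vanishing on \<open>W\<close> but not at \<open>t\<close> would be a form that vanishes on \<open>X\<close> but not under \<open>\<phi>\<close>.
\<close>

lemma dual_subset_pairing_functional_image:
  assumes \<phi>: "\<phi> \<in> dual H" shows "\<phi> \<in> pairing_functional ` W"
proof -
  let ?M = "multisets_of_size I d"
  have finM: "finite ?M" using I by (rule finite_multisets_of_size)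
  define t where "t m = (if m \<in> ?M then \<phi> (section_of_form X (Poly_Mapping.single m 1)) else 0)" for m
  have add: "\<phi> (section_of_form X (F + G)) = \<phi> (section_of_form X F) + \<phi> (section_of_form X G)"
    if "F \<in> forms I d" "G \<in> forms I d" for F G
  proof -
    have "section_of_form X F \<in> H" "section_of_form X G \<in> H" using that H by blast+
    then show ?thesis using \<phi> by (simp add: dual_def section_of_form_add)
  qed
  have scale: "\<phi> (section_of_form X (pscale c F)) = c * \<phi> (section_of_form X F)"
    if "F \<in> forms I d" for c F
  proof -
    have "section_of_form X F \<in> H" using that H by blast
    then show ?thesis using \<phi> by (simp add: dual_def section_of_form_pscale)
  qed
  have \<phi>_form: "\<phi> (section_of_form X F) = form_pairing I d F t" if F: "F \<in> forms I d" for F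
  proof -
    have "\<phi> (section_of_form X (\<Sum>m\<in>A. Poly_Mapping.single m (Poly_Mapping.lookup F m)))
        = (\<Sum>m\<in>A. Poly_Mapping.lookup F m * t m)" if "finite A" "A \<subseteq> ?M" for A
      using that
    proof (induction A rule: finite_induct)
      case empty
      show ?case using scale[of 0 0] pvec.scale_zero_left[of 0] by (simp only: sum.empty) simp
    next
      case (insert m A)
      have "Poly_Mapping.single m (Poly_Mapping.lookup F m) = pscale (Poly_Mapping.lookup F m) (Poly_Mapping.single m 1)"
        by (rule poly_mapping_eqI) (simp add: lookup_single when_def)
      then have "\<phi> (section_of_form X (Poly_Mapping.single m (Poly_Mapping.lookup F m))) = Poly_Mapping.lookup F m * t m"
        using insert.prems scale[OF forms_single] by (simp add: t_def)
      moreover have "(\<Sum>m\<in>A. Poly_Mapping.single m (Poly_Mapping.lookup F m)) \<in> forms I d"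
        using insert.prems by (intro forms_sum forms_single) auto
      ultimately show ?case using insert
        by (simp add: add forms_single)
    qed
    from this[of ?M] have "\<phi> (section_of_form X (\<Sum>m\<in>?M. Poly_Mapping.single m (Poly_Mapping.lookup F m)))
        = form_pairing I d F t" using finM by (simp add: form_pairing_def)
    moreover have "(\<Sum>m\<in>?M. Poly_Mapping.single m (Poly_Mapping.lookup F m)) = F"
    proof -
      have "(\<Sum>m\<in>Poly_Mapping.keys F. Poly_Mapping.single m (Poly_Mapping.lookup F m))
          = (\<Sum>m\<in>?M. Poly_Mapping.single m (Poly_Mapping.lookup F m))"
        using F finM by (intro sum.mono_neutral_left) (auto simp: forms_def in_keys_iff)
      then show ?thesis using mpol_sum_single[of F] by simp
    qed
    ultimately show ?thesis by simp
  qed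
  have "t \<in> W"
  proof (rule ccontr)
    assume "t \<notin> W"
    then obtain g where g: "linear_functional g" "\<And>w. w \<in> cone X \<Longrightarrow> g (veronese_vec I d w) = 0" "g t = 1"
      unfolding W using ex_separating_functional by blast
    define F where "F = (\<Sum>m\<in>?M. Poly_Mapping.single m (g (unit_vec m)))"
    have F: "F \<in> forms I d" unfolding F_def by (intro forms_sum forms_single)
    have "Poly_Mapping.lookup F m = g (unit_vec m)" if "m \<in> ?M" for m
      using that finM by (simp add: F_def lookup_sum lookup_single when_def)
    then have gF: "form_pairing I d F u = g u" if "\<And>m. m \<notin> ?M \<Longrightarrow> u m = 0" for u
      using linear_functional_coordinates[OF g(1) finM that] by (simp add: form_pairing_def)
    have "section_of_form X F = section_of_form X 0"
    proof
      fix w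
      have "peval F w = 0" if "w \<in> cone X"
        using gF[of "veronese_vec I d w"] g(2)[OF that] form_pairing_veronese[OF I F]
        by (simp add: veronese_vec_def)
      then show "section_of_form X F w = section_of_form X 0 w" by (simp add: section_of_form_def)
    qed
    then have "form_pairing I d F t = form_pairing I d 0 t"
      using \<phi>_form[OF F] \<phi>_form[OF forms_0] by simp
    moreover have "form_pairing I d F t = 1" using gF[of t] g(3) by (simp add: t_def)
    ultimately show False by (simp add: form_pairing_def)
  qed
  moreover have "pairing_functional t = \<phi>"
  proof
    fix s
    show "pairing_functional t s = \<phi> s"
    proof (cases "s \<in> H")
      case True
      then obtain F where "F \<in> forms I d" "s = section_of_form X F" using H by blast
      then show ?thesis using \<phi>_form pairing_functional_section \<open>t \<in> W\<close> by simp
    next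
      case False
      then show ?thesis using \<phi> by (simp add: pairing_functional_def dual_def)
    qed
  qed
  ultimately show ?thesis by blast
qed

lemma bij_betw_pairing_functional: "bij_betw pairing_functional W (dual H)"
  unfolding bij_betw_def
  using inj_on_pairing_functional pairing_functional_in_dual dual_subset_pairing_functional_image
  by blast

end

section \<open>Projective equivalence\<close>

lemma finite_pluecker_index: "finite (pluecker_index n)"
  by (rule finite_subset[of _ "{..n} \<times> {..n}"]) (auto simp: pluecker_index_def)

lemma proj_equiv_trans:
  assumes "proj_equiv s V X s' W Y" "proj_equiv s' W Y s'' U Z"
  shows "proj_equiv s V X s'' U Z"
proof -
  obtain f where f: "Vector_Spaces.linear s s' f" "bij_betw f V W" "(\<lambda>L. f ` L) ` X = Y"
    using assms(1) unfolding proj_equiv_def by blast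
  obtain g where g: "Vector_Spaces.linear s' s'' g" "bij_betw g W U" "(\<lambda>L. g ` L) ` Y = Z"
    using assms(2) unfolding proj_equiv_def by blast
  have "(\<lambda>L. (g \<circ> f) ` L) ` X = Z" unfolding f(3)[symmetric] g(3)[symmetric] by (simp add: image_image image_comp)
  then show ?thesis unfolding proj_equiv_def
    using Vector_Spaces.linear_compose[OF f(1) g(1)] bij_betw_trans[OF f(2) g(2)] by blast
qed

lemma veronese_pluecker_vec:
  "veronese_vec (pluecker_index n) 2 (pluecker_vec n a b) = veronese_vec (pluecker_index n) 2 (wedge a b)"
  by (rule veronese_vec_cong) (auto simp: pluecker_vec_apply wedge_def pluecker_index_def)

lemma veronese_vec_0: "veronese_vec I 2 (0 :: 'i \<Rightarrow> 'k::field) = 0"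
  using veronese_vec_fscale[of I 0 "0 :: 'i \<Rightarrow> 'k"] by simp

text \<open>
  The Veronese coordinates include the squares of all coordinates.
\<close>

lemma veronese_pluecker_vec_eq_0:
  assumes "veronese_vec (pluecker_index n) 2 (pluecker_vec n a b) = 0"
  shows "pluecker_vec n a b = (0 :: _ \<Rightarrow> 'k::field)"
proof
  fix p show "pluecker_vec n a b p = 0 p"
    using fun_cong[OF assms, of "{#p, p#}"]
    by (cases p; cases "p \<in> pluecker_index n") (auto simp: veronese_vec_pair pluecker_vec_apply)
qed

lemma veronese_pluecker:
  "veronese (pluecker_index n) 2 (pluecker n) =
    {fvec.span {veronese_vec (pluecker_index n) 2 (wedge a b)} | a b :: nat \<Rightarrow> 'k::field.
      veronese_vec (pluecker_index n) 2 (wedge a b) \<noteq> 0}"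
proof (intro equalityI subsetI)
  fix L :: "((nat \<times> nat) multiset \<Rightarrow> 'k) set" assume "L \<in> veronese (pluecker_index n) 2 (pluecker n)"
  then obtain a b :: "nat \<Rightarrow> 'k" where "L = fvec.span {veronese_vec (pluecker_index n) 2 (pluecker_vec n a b)}"
      "pluecker_vec n a b \<noteq> 0"
    unfolding veronese_def cone_pluecker by blast
  then show "L \<in> {fvec.span {veronese_vec (pluecker_index n) 2 (wedge a b)} | a b.
      veronese_vec (pluecker_index n) 2 (wedge a b) \<noteq> 0}"
    using veronese_pluecker_vec_eq_0[of n a b] unfolding veronese_pluecker_vec by blast
next
  fix L :: "((nat \<times> nat) multiset \<Rightarrow> 'k) set"
  assume "L \<in> {fvec.span {veronese_vec (pluecker_index n) 2 (wedge a b)} | a b.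
      veronese_vec (pluecker_index n) 2 (wedge a b) \<noteq> 0}"
  then obtain a b :: "nat \<Rightarrow> 'k" where ab: "L = fvec.span {veronese_vec (pluecker_index n) 2 (pluecker_vec n a b)}"
      "veronese_vec (pluecker_index n) 2 (pluecker_vec n a b) \<noteq> 0"
    unfolding veronese_pluecker_vec by blast
  then have "pluecker_vec n a b \<in> cone (pluecker n)"
    unfolding cone_pluecker by (auto simp: veronese_vec_0)
  then show "L \<in> veronese (pluecker_index n) 2 (pluecker n)" unfolding veronese_def ab by blast
qed

lemma span_cone_veronese:
  "fvec.span (cone (veronese I 2 X)) = fvec.span (veronese_vec I 2 ` cone (X :: ('i \<Rightarrow> 'k::field) set set))"
proof (rule fvec.span_eq[THEN iffD2], intro conjI subsetI)
  fix t assume "t \<in> cone (veronese I 2 X)"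
  then obtain c w where "t = fscale c (veronese_vec I 2 w)" "w \<in> cone X"
    unfolding veronese_def cone_span by blast
  then show "t \<in> fvec.span (veronese_vec I 2 ` cone X)" by (auto intro: fvec.span_scale fvec.span_base)
next
  fix t assume "t \<in> veronese_vec I 2 ` cone X"
  then obtain w where w: "t = veronese_vec I 2 w" "w \<in> cone X" by blast
  show "t \<in> fvec.span (cone (veronese I 2 X))"
  proof (cases "t = 0")
    case False
    have "t = fscale 1 (veronese_vec I 2 w)" by (simp add: w)
    then have "t \<in> cone (veronese I 2 X)" using w False unfolding veronese_def cone_span by blast
    then show ?thesis by (rule fvec.span_base)
  qed (simp add: fvec.span_zero)
qed

lemma span_veronese_cone_pluecker:
  "fvec.span (veronese_vec (pluecker_index n) 2 ` cone (pluecker n)) =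
    fvec.span {veronese_vec (pluecker_index n) 2 (wedge a b) | a b :: nat \<Rightarrow> 'k::field. True}"
proof (rule fvec.span_eq[THEN iffD2], intro conjI subsetI)
  fix t :: "(nat \<times> nat) multiset \<Rightarrow> 'k" assume "t \<in> veronese_vec (pluecker_index n) 2 ` cone (pluecker n)"
  then obtain a b where "t = veronese_vec (pluecker_index n) 2 (pluecker_vec n a b)"
    unfolding cone_pluecker by blast
  then show "t \<in> fvec.span {veronese_vec (pluecker_index n) 2 (wedge a b) | a b. True}"
    unfolding veronese_pluecker_vec by (intro fvec.span_base) blast
next
  fix t :: "(nat \<times> nat) multiset \<Rightarrow> 'k"
  assume "t \<in> {veronese_vec (pluecker_index n) 2 (wedge a b) | a b. True}"
  then obtain a b where t: "t = veronese_vec (pluecker_index n) 2 (pluecker_vec n a b)"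
    unfolding veronese_pluecker_vec by blast
  show "t \<in> fvec.span (veronese_vec (pluecker_index n) 2 ` cone (pluecker n))"
  proof (cases "pluecker_vec n a b = 0")
    case True
    then show ?thesis by (simp add: t veronese_vec_0 fvec.span_zero)
  next
    case False
    then show ?thesis unfolding t cone_pluecker by (intro fvec.span_base) blast
  qed
qed

text \<open>
  The linear map \<open>bivector_of\<close> is injective on the ideal, and it takes the pencil quadric of \<open>a\<close> and \<open>b\<close>
  to the Veronese point of \<open>a \<and> b\<close>. As pencil quadrics span the ideal, Veronese points span its image.
\<close>

lemma proj_equiv_Phi3_veronese_pluecker:
  assumes two: "(2::'k::alg_closed_field) \<noteq> 0" and three: "(3::'k) \<noteq> 0"
  shows "proj_equiv pscale (veronese_ideal_2 n :: (nat multiset, 'k) mpol set) (Phi3 n)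
    fscale (fvec.span (cone (veronese (pluecker_index n) 2 (pluecker n))))
      (veronese (pluecker_index n) 2 (pluecker n))"
proof -
  let ?f = "bivector_of n :: (nat multiset, 'k) mpol \<Rightarrow> _"
  let ?w = "\<lambda>a b :: nat \<Rightarrow> 'k. veronese_vec (pluecker_index n) 2 (wedge a b)"
  interpret f: Vector_Spaces.linear pscale fscale ?f by (rule linear_bivector_of)
  note pencil = bivector_of_pencil_quadric[OF two three]
  have "inj_on ?f (veronese_ideal_2 n)"
  proof (rule inj_onI)
    fix Q Q' :: "(nat multiset, 'k) mpol"
    assume Q: "Q \<in> veronese_ideal_2 n" "Q' \<in> veronese_ideal_2 n" "?f Q = ?f Q'"
    then have "Q - Q' \<in> veronese_ideal_2 n"
      unfolding veronese_ideal_2_eq_span[OF two three] by (intro pvec.span_diff)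
    from bivector_of_eq_0[OF two three this] Q(3) show "Q = Q'" by (simp add: f.diff)
  qed
  moreover have "?f ` veronese_ideal_2 n = fvec.span {?w a b | a b. True}"
  proof -
    have "?f ` {pencil_quadric n a b | a b. True} = {?w a b | a b. True}"
      by (auto simp: pencil[symmetric])
    then show ?thesis unfolding veronese_ideal_2_eq_span[OF two three] by (simp flip: f.span_image)
  qed
  ultimately have "bij_betw ?f (veronese_ideal_2 n) (fvec.span (cone (veronese (pluecker_index n) 2 (pluecker n))))"
    unfolding span_cone_veronese span_veronese_cone_pluecker by (simp add: bij_betw_def)
  moreover have "(\<lambda>L. ?f ` L) ` Phi3 n = veronese (pluecker_index n) 2 (pluecker n)"
  proof -
    have span: "?f ` pvec.span {pencil_quadric n a b} = fvec.span {?w a b}" for a b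
      using f.span_image[of "{pencil_quadric n a b}"] by (simp add: pencil)
    have nonzero: "pencil_quadric n a b \<noteq> 0 \<longleftrightarrow> ?w a b \<noteq> 0" for a b
      using bivector_of_eq_0[OF two three pencil_quadric_in_ideal[of n a b]] f.zero pencil[of n a b] by metis
    show ?thesis unfolding Phi3_eq[OF two] veronese_pluecker nonzero[symmetric]
    proof (intro equalityI subsetI)
      fix L assume "L \<in> (\<lambda>L. ?f ` L) ` {pvec.span {pencil_quadric n a b} | a b. pencil_quadric n a b \<noteq> 0}"
      then obtain a b where "L = ?f ` pvec.span {pencil_quadric n a b}" "pencil_quadric n a b \<noteq> 0" by blast
      then show "L \<in> {fvec.span {?w a b} | a b. pencil_quadric n a b \<noteq> 0}" unfolding span by blast
    next
      fix L assume "L \<in> {fvec.span {?w a b} | a b. pencil_quadric n a b \<noteq> 0}"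
      then obtain a b where "L = ?f ` pvec.span {pencil_quadric n a b}" "pencil_quadric n a b \<noteq> 0"
        unfolding span[symmetric] by blast
      then show "L \<in> (\<lambda>L. ?f ` L) ` {pvec.span {pencil_quadric n a b} | a b. pencil_quadric n a b \<noteq> 0}"
        by blast
    qed
  qed
  ultimately show ?thesis unfolding proj_equiv_def using linear_bivector_of by blast
qed

lemma proj_equiv_veronese_linear_system:
  fixes X :: "('i \<Rightarrow> 'k::field) set set"
  assumes I: "finite I" and H: "global_sections I X 2 = section_of_form X ` forms I 2"
  shows "proj_equiv fscale (fvec.span (cone (veronese I 2 X))) (veronese I 2 X)
    fscale (dual (global_sections I X 2)) (linear_system_image I X 2)"
proof -
  let ?H = "global_sections I X 2"
  let ?E = "pairing_functional I X 2 ?H"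
  interpret E: Vector_Spaces.linear fscale fscale ?E
    by (rule linear_pairing_functional[OF I H refl])
  have "bij_betw ?E (fvec.span (cone (veronese I 2 X))) (dual ?H)"
    unfolding span_cone_veronese by (rule bij_betw_pairing_functional[OF I H refl])
  moreover have "(\<lambda>L. ?E ` L) ` veronese I 2 X = linear_system_image I X 2"
  proof -
    have span: "?E ` fvec.span {veronese_vec I 2 w} = fvec.span {evaluation ?H w}" if "w \<in> cone X" for w
      using E.span_image[of "{veronese_vec I 2 w}"] pairing_functional_veronese[OF I H refl that] by simp
    then show ?thesis unfolding veronese_def linear_system_image_def by (auto simp: image_iff)
  qed
  ultimately show ?thesis unfolding proj_equiv_def using E.linear_axioms by blast
qed

theorem corollary1p4:
  fixes n :: nat
  assumes "CHAR('k::alg_closed_field) \<noteq> 2" and "CHAR('k) \<noteq> 3" and "n \<ge> 1"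
  shows
    "proj_equiv pscale (veronese_ideal_2 n :: (nat multiset, 'k) mpol set) (Phi3 n)
       fscale (fvec.span (cone (veronese (pluecker_index n) 2 (pluecker n))))
         (veronese (pluecker_index n) 2 (pluecker n)) \<and>
     proj_equiv pscale (veronese_ideal_2 n :: (nat multiset, 'k) mpol set) (Phi3 n)
       fscale (dual (global_sections (pluecker_index n) (pluecker n) 2))
         (linear_system_image (pluecker_index n) (pluecker n) 2)"
proof -
  have two: "(2::'k) \<noteq> 0" and three: "(3::'k) \<noteq> 0"
    using assms two_neq_0_if_CHAR three_neq_0_if_CHAR by blast+
  note 1 = proj_equiv_Phi3_veronese_pluecker[OF two three, of n]
  have "proj_equiv fscale (fvec.span (cone (veronese (pluecker_index n) 2 (pluecker n))))
      (veronese (pluecker_index n) 2 (pluecker n))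
      fscale (dual (global_sections (pluecker_index n) (pluecker n :: (_ \<Rightarrow> 'k) set set) 2))
      (linear_system_image (pluecker_index n) (pluecker n) 2)"
    by (rule proj_equiv_veronese_linear_system[OF finite_pluecker_index global_sections_pluecker[OF two three]])
  from 1 proj_equiv_trans[OF 1 this] show ?thesis by blast
qed

end
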